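(* For every integer $k\ge 1$ there exists $n_0$ such that for every $n\ge n_0$, writing $n=qk+r$ with $0\le r<k$, $$\mathrm{ex}(n,\overrightarrow{P_{k+1}})=a(\overrightarrow{T_{n,k}})=\frac{k-1}{2k}n^2-\frac{r(k-r)}{2k},$$ and $\mathrm{EX}(n,\overrightarrow{P_{k+1}})=\overrightarrow{\mathcal{T}_{n,k}}$.
   Context: Digraphs are finite and strict: no loops and no parallel arcs in the same direction, but both arcs $uv$ and $vu$ may be present. $a(D)$ denotes the number of arcs of a digraph $D$. $\overrightarrow{P_k}$ is the directed path with $k$ vertices (all arcs oriented consistently along the path). A digraph is $H$-free if it contains no (not necessarily induced) subdigraph isomorphic to the digraph $H$. $\mathrm{ex}(n,H)$ is the maximum number of arcs of an $H$-free digraph on $n$ vertices, and $\mathrm{EX}(n,H)$ is the family of all $H$-free digraphs on $n$ vertices with exactly $\mathrm{ex}(n,H)$ arcs. Families of digraphs are considered up to isomorphism. For disjoint vertex sets $U,W$ of a digraph, $U\mapsto W$ means that $uw$ is an arc and $wu$ is not an arc for all $u\in U$, $w\in W$. For $n\ge k\ge 1$, $\overrightarrow{\mathcal{T}_{n,k}}$ is the set of all digraphs $\overrightarrow{T_{n,k}}$ on $n$ vertices whose vertex set has a partition $\{V_1,\dots,V_k\}$ such that: (i) the sizes of the parts differ pairwise by at most $1$; (ii) each $V_i$ is independent (no arcs inside $V_i$); (iii) $V_i\mapsto V_j$ for all $1\le i<j\le k$. All members of $\overrightarrow{\mathcal{T}_{n,k}}$ have the same number of arcs, denoted $a(\overrightarrow{T_{n,k}})$.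 *)

theory Defs
  imports
    Complex_Main
    "HOL-Library.Disjoint_Sets"
    "Graph_Theory.Pair_Digraph"
    "Graph_Theory.Digraph_Component"
    "Graph_Theory.Digraph_Isomorphism"
begin

text \<open>
  Finite strict digraphs are the structures satisfying \<^const>\<open>pair_digraph\<close>: arcs are a finite set of
  ordered pairs of distinct vertices, so parallel arcs are excluded by the representation and
  opposite arcs are allowed. Families of digraphs up to isomorphism are represented by
  isomorphism-closed sets of digraphs whose vertices are natural numbers; every finite digraph has
  an isomorphic copy of this form, so two such families agree up to isomorphism iff the sets are equal.
\<close>

definition num_arcs :: "'a pair_pre_digraph \<Rightarrow> nat" where
  "num_arcs D = card (parcs D)"

definition H_free :: "'b pair_pre_digraph \<Rightarrow> 'a pair_pre_digraph \<Rightarrow> bool" where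
  "H_free H D \<longleftrightarrow> \<not> (\<exists>S. subgraph S (with_proj D) \<and> digraph_iso (with_proj H) S)"

definition free_digraphs :: "nat \<Rightarrow> 'b pair_pre_digraph \<Rightarrow> nat pair_pre_digraph set" where
  "free_digraphs n H = {D. pair_digraph D \<and> card (pverts D) = n \<and> H_free H D}"

text \<open>
  The set of arc numbers is finite (bounded by $n^2$). It is nonempty as soon as some $H$-free
  digraph on $n$ vertices exists, e.g. whenever $H$ has an arc.
\<close>

definition ex_num :: "nat \<Rightarrow> 'b pair_pre_digraph \<Rightarrow> nat" where
  "ex_num n H = Max (num_arcs ` free_digraphs n H)"

definition EX_fam :: "nat \<Rightarrow> 'b pair_pre_digraph \<Rightarrow> nat pair_pre_digraph set" where
  "EX_fam n H = {D \<in> free_digraphs n H. num_arcs D = ex_num n H}"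

definition dpath :: "nat \<Rightarrow> nat pair_pre_digraph" where
  "dpath k = \<lparr> pverts = {..<k}, parcs = {(i, Suc i) | i. Suc i < k} \<rparr>"

definition mapsto :: "'a pair_pre_digraph \<Rightarrow> 'a set \<Rightarrow> 'a set \<Rightarrow> bool" where
  "mapsto D U W \<longleftrightarrow> (\<forall>u\<in>U. \<forall>w\<in>W. (u, w) \<in> parcs D \<and> (w, u) \<notin> parcs D)"

definition turan_digraphs :: "nat \<Rightarrow> nat \<Rightarrow> nat pair_pre_digraph set" where
  "turan_digraphs n k = {D. pair_digraph D \<and> card (pverts D) = n \<and>
     (\<exists>V :: nat \<Rightarrow> nat set.
        partition_on (pverts D) (V ` {1..k}) \<and> inj_on V {1..k} \<and>
        (\<forall>i\<in>{1..k}. \<forall>j\<in>{1..k}. card (V i) \<le> card (V j) + 1) \<and>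
        (\<forall>i\<in>{1..k}. \<forall>u\<in>V i. \<forall>v\<in>V i. (u, v) \<notin> parcs D) \<and>
        (\<forall>i\<in>{1..k}. \<forall>j\<in>{1..k}. i < j \<longrightarrow> mapsto D (V i) (V j)))}"

end

theory Submission
  imports Defs
begin

text \<open>
  Call a digraph without a directed path on $k+1$ vertices admissible. If $S$ spans a path on $k$
  vertices, every outside vertex sends and receives at most $k-1$ arcs to and from $S$ in total.
  An admissible digraph with at least $\frac{k-1}{2k}n^2 - O(1)$ arcs has only $O(n)$ pairs of
  opposite arcs, so a weak Turan bound, applied after discarding these pairs and the vertices lying
  on many of them, gives $k$ vertices inducing a tournament, hence a path $S$ with only
  $\binom{k}{2}$ arcs inside. Removing such sets $S$ repeatedly shows that the arc number never
  exceeds $\frac{k-1}{2k}n^2$ by more than a constant depending on $k$; in turn, a near-extremal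
  digraph has large minimum degree, and all but boundedly many vertices see $S$ exactly like a
  vertex of a transitive blow-up of $S$. These vertices form $k$ independent classes of size about
  $n/k$ with almost all arcs pointing forward. Since paths can be prolonged greedily through the
  classes, a path on $k+1$ vertices arises unless every remaining vertex fits into one class, so
  all arcs go forward along a $k$-partition. It remains to maximise the number of forward pairs.
\<close>

section \<open>Arc counts and weak extremal bounds\<close>

text \<open>The errors must stay O(1): an error linear in n in the arc bound would become an error
  of the same order in the minimum degree, and the classes would no longer be forced. With f(n) =
  (k-1)n^2/(2k) one has f(n) - f(n-k) = binom(k,2) + (n-k)(k-1), so deleting a path S with only
  binom(k,2) arcs inside loses nothing, whereas k(k-1) arcs inside S could cost a constant in each
  of about n/k rounds. Opposite arcs are thus the obstacle. They form a symmetric relation without a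
  path on k+1 vertices, and in a symmetric relation large minimum degree yields a long path
  greedily; hence there are only O(n) of them. The constant error is then used twice more: deleting
  one vertex turns it into a degree bound, and deleting S turns it into a bound on the number of
  vertices joined to S by fewer than k-1 arcs. These constants are collected in \<open>Q\<close>,
  and the exceptional vertices are finally placed by an argument that treats all vertices of V
  alike.\<close>

definition dipath :: "('a \<times> 'a) set \<Rightarrow> 'a list \<Rightarrow> bool" where
  "dipath E p \<longleftrightarrow> distinct p \<and> successively (\<lambda>x y. (x, y) \<in> E) p"

text \<open>The relation stays fixed and only the vertex set shrinks, so the inductions by vertex
  deletion never restrict \<open>E\<close>.\<close>

definition path_bounded :: "('a \<times> 'a) set \<Rightarrow> nat \<Rightarrow> 'a set \<Rightarrow> bool" where
  "path_bounded E k V \<longleftrightarrow> (\<forall>p. dipath E p \<longrightarrow> set p \<subseteq> V \<longrightarrow> length p \<le> k)"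

definition arcs_in :: "('a \<times> 'a) set \<Rightarrow> 'a set \<Rightarrow> nat" where
  "arcs_in E X = card (E \<inter> X \<times> X)"

definition deg :: "('a \<times> 'a) set \<Rightarrow> 'a \<Rightarrow> 'a set \<Rightarrow> nat" where
  "deg E v X = card {x \<in> X. (x, v) \<in> E} + card {x \<in> X. (v, x) \<in> E}"

lemma path_bounded_mono: "path_bounded E k V \<Longrightarrow> X \<subseteq> V \<Longrightarrow> path_bounded E k X"
  unfolding path_bounded_def by blast

lemma arcs_in_le:
  assumes "finite X"
  shows "arcs_in E X \<le> card X * card X"
proof -
  have "card (E \<inter> X \<times> X) \<le> card (X \<times> X)"
    by (intro card_mono) (use assms in auto)
  thus ?thesis by (simp add: arcs_in_def card_cartesian_product)
qed

lemma arcs_in_singleton: "irrefl E \<Longrightarrow> arcs_in E {v} = 0"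
  by (auto simp: arcs_in_def irrefl_def)

lemma deg_le: "finite X \<Longrightarrow> deg E v X \<le> 2 * card X"
proof -
  assume X: "finite X"
  have "card {x \<in> X. (x, v) \<in> E} \<le> card X" "card {x \<in> X. (v, x) \<in> E} \<le> card X"
    by (auto intro!: card_mono X)
  thus ?thesis by (simp add: deg_def)
qed

lemma deg_Un:
  assumes "finite X" "finite Y" "X \<inter> Y = {}"
  shows "deg E v (X \<union> Y) = deg E v X + deg E v Y"
proof -
  have *: "card {x \<in> X \<union> Y. P x} = card {x \<in> X. P x} + card {x \<in> Y. P x}" for P
  proof -
    have "{x \<in> X \<union> Y. P x} = {x \<in> X. P x} \<union> {x \<in> Y. P x}" by blast
    thus ?thesis using assms by (simp add: card_Un_disjoint disjoint_iff)
  qed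
  show ?thesis unfolding deg_def * by simp
qed

lemma deg_UN:
  assumes "finite I" "\<And>i. i \<in> I \<Longrightarrow> finite (U i)" "disjoint_family_on U I"
  shows "deg E v (\<Union>i\<in>I. U i) = (\<Sum>i\<in>I. deg E v (U i))"
  using assms
proof (induction I rule: finite_induct)
  case empty
  show ?case by (simp add: deg_def)
next
  case (insert a I)
  have "U a \<inter> (\<Union>i\<in>I. U i) = {}"
    using insert.prems(2) insert.hyps by (auto simp: disjoint_family_on_def)
  moreover have "disjoint_family_on U I"
    using insert.prems(2) by (auto simp: disjoint_family_on_def)
  ultimately show ?case using insert by (simp add: deg_Un)
qed

lemma card_pairs_eq_sum:
  assumes "finite X" "finite Y"
  shows "card {(x, y). x \<in> X \<and> y \<in> Y \<and> P x y} = (\<Sum>x\<in>X. card {y \<in> Y. P x y})"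
proof -
  have "{(x, y). x \<in> X \<and> y \<in> Y \<and> P x y} = (SIGMA x:X. {y \<in> Y. P x y})" by auto
  thus ?thesis using assms by simp
qed

lemma arcs_in_split:
  assumes "finite X" "S \<subseteq> X"
  shows "arcs_in E X = arcs_in E (X - S) + arcs_in E S + (\<Sum>v\<in>X - S. deg E v S)"
proof -
  have S: "finite S" using assms finite_subset by blast
  define A where "A = {(v, x). v \<in> X - S \<and> x \<in> S \<and> (v, x) \<in> E}"
  \<comment> \<open>Pairs of \<open>B\<close> also carry the outside vertex first, so both families
    of crossing arcs are summed over \<open>X - S\<close>.\<close>
  define B where "B = {(v, x). v \<in> X - S \<and> x \<in> S \<and> (x, v) \<in> E}"
  have fin: "finite A" "finite B"
    by (rule finite_subset[of _ "X \<times> X"], use assms A_def B_def in auto)+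
  have cB: "card ((\<lambda>(v, x). (x, v)) ` B) = card B"
    by (rule card_image) (auto simp: inj_on_def)
  have eq: "E \<inter> X \<times> X = ((E \<inter> (X - S) \<times> (X - S)) \<union> (E \<inter> S \<times> S)) \<union> (A \<union> (\<lambda>(v, x). (x, v)) ` B)"
    using assms(2) unfolding A_def B_def by auto
  have "card (E \<inter> X \<times> X) = card ((E \<inter> (X - S) \<times> (X - S)) \<union> (E \<inter> S \<times> S))
      + card (A \<union> (\<lambda>(v, x). (x, v)) ` B)"
    unfolding eq by (rule card_Un_disjoint) (use assms S fin in \<open>auto simp: A_def B_def\<close>)
  also have "card ((E \<inter> (X - S) \<times> (X - S)) \<union> (E \<inter> S \<times> S)) = arcs_in E (X - S) + arcs_in E S"
    unfolding arcs_in_def by (rule card_Un_disjoint) (use assms S in auto)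
  also have "card (A \<union> (\<lambda>(v, x). (x, v)) ` B) = card A + card B"
    unfolding cB[symmetric] by (rule card_Un_disjoint) (use fin in \<open>auto simp: A_def B_def\<close>)
  also have "card A = (\<Sum>v\<in>X - S. card {x \<in> S. (v, x) \<in> E})"
    unfolding A_def by (rule card_pairs_eq_sum) (use assms S in auto)
  also have "card B = (\<Sum>v\<in>X - S. card {x \<in> S. (x, v) \<in> E})"
    unfolding B_def by (rule card_pairs_eq_sum) (use assms S in auto)
  finally show ?thesis by (simp add: arcs_in_def deg_def sum.distrib algebra_simps)
qed

lemma arcs_in_remove:
  assumes "finite X" "v \<in> X" "irrefl E"
  shows "arcs_in E X = arcs_in E (X - {v}) + deg E v (X - {v})"
proof -
  have "X - (X - {v}) = {v}" using assms(2) by blast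
  thus ?thesis
    using arcs_in_split[OF assms(1), of "X - {v}" E] arcs_in_singleton[OF assms(3), of v] by simp
qed

lemma deg_remove_self:
  assumes "irrefl E"
  shows "deg E v (X - {v}) = deg E v X"
proof -
  have "{x \<in> X - {v}. (x, v) \<in> E} = {x \<in> X. (x, v) \<in> E}"
       "{x \<in> X - {v}. (v, x) \<in> E} = {x \<in> X. (v, x) \<in> E}"
    using assms by (auto simp: irrefl_def)
  thus ?thesis by (simp add: deg_def)
qed

section \<open>Turan's bound for symmetric relations without large cliques\<close>

lemma turan_step_arith:
  fixes a e r n :: real
  assumes "r \<ge> 0" "e \<le> a + (r + 1) * r + (n - (r + 1)) * (2 * r)"
    and "(r + 1) * a \<le> r * (n - (r + 1))\<^sup>2"
  shows "(r + 1) * e \<le> r * n\<^sup>2"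
proof -
  have "(r + 1) * e \<le> (r + 1) * (a + (r + 1) * r + (n - (r + 1)) * (2 * r))"
    by (rule mult_left_mono) (use assms in auto)
  also have "\<dots> \<le> r * (n - (r + 1))\<^sup>2 + (r + 1) * ((r + 1) * r + (n - (r + 1)) * (2 * r))"
    using assms(3) by (simp add: algebra_simps)
  also have "\<dots> = r * n\<^sup>2" by (simp add: algebra_simps power2_eq_square)
  finally show ?thesis .
qed

text \<open>Each edge counts as two arcs, so this is Turan's edge bound (1 - 1/r)n^2/2 multiplied by
  2r. The outer induction lowers r when V has no clique of the next smaller order; otherwise the
  inner induction deletes such a clique, which is then maximum.\<close>

lemma turan_weak:
  assumes "finite V" "irrefl A" "sym A"
    and "\<And>K. K \<subseteq> V \<Longrightarrow> card K = Suc r \<Longrightarrow> \<exists>x\<in>K. \<exists>y\<in>K. x \<noteq> y \<and> (x, y) \<notin> A"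
  shows "real r * real (arcs_in A V) \<le> (real r - 1) * (real (card V))\<^sup>2"
  using assms
proof (induction r arbitrary: V)
  case 0
  have "V = {}"
  proof (rule ccontr)
    assume "V \<noteq> {}"
    then obtain x where "x \<in> V" by blast
    from "0.prems"(4)[of "{x}"] this show False by simp
  qed
  thus ?case by simp
next
  case (Suc r)
  note IHr = Suc.IH
  show ?case using Suc.prems
  proof (induction "card V" arbitrary: V rule: less_induct)
    case less
    show ?case
    proof (cases "\<exists>K\<subseteq>V. card K = Suc r \<and> (\<forall>x\<in>K. \<forall>y\<in>K. x \<noteq> y \<longrightarrow> (x, y) \<in> A)")
      case False
      hence ih: "real r * real (arcs_in A V) \<le> (real r - 1) * (real (card V))\<^sup>2"
        by (intro IHr) (use less.prems in auto)
      show ?thesis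
      proof (cases "r = 0")
        case True
        \<comment> \<open>For r = 0 the induction hypothesis reads 0 <= -|V|^2.\<close>
        hence "card V = 0" using ih by simp
        hence "V = {}" using less.prems(1) by simp
        thus ?thesis by (simp add: arcs_in_def)
      next
        case r: False
        have "real r * (real (Suc r) * real (arcs_in A V)) \<le> real (Suc r) * ((real r - 1) * (real (card V))\<^sup>2)"
          using mult_left_mono[OF ih, of "real (Suc r)"] by (simp add: algebra_simps)
        also have "\<dots> = ((real r)\<^sup>2 - 1) * (real (card V))\<^sup>2"
          by (simp add: algebra_simps power2_eq_square)
        also have "\<dots> \<le> (real r)\<^sup>2 * (real (card V))\<^sup>2" by (intro mult_right_mono) auto
        also have "\<dots> = real r * ((real (Suc r) - 1) * (real (card V))\<^sup>2)"
          by (simp add: power2_eq_square)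
        finally show ?thesis using r by (simp del: of_nat_Suc)
      qed
    next
      case True
      then obtain K where K: "K \<subseteq> V" "card K = Suc r" "\<forall>x\<in>K. \<forall>y\<in>K. x \<noteq> y \<longrightarrow> (x, y) \<in> A" by blast
      have fK: "finite K" using K(2) card_ge_0_finite by force
      have cV: "card V \<ge> Suc r" using K less.prems(1) card_mono by metis
      have cVK: "card (V - K) = card V - Suc r" using K fK by (simp add: card_Diff_subset)
      \<comment> \<open>A vertex joined to all of \<open>K\<close> would enlarge it to a forbidden
        clique. So v misses some z in \<open>K\<close>, in both directions by symmetry.\<close>
      have dg: "deg A v K \<le> 2 * r" if v: "v \<in> V - K" for v
      proof -
        have "\<exists>x\<in>insert v K. \<exists>y\<in>insert v K. x \<noteq> y \<and> (x, y) \<notin> A"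
          by (rule less.prems(4)) (use v K fK in auto)
        then obtain x y where "x \<in> insert v K" "y \<in> insert v K" "x \<noteq> y" "(x, y) \<notin> A"
          by blast
        hence "\<exists>z\<in>K. (v, z) \<notin> A" using K(3) symD[OF less.prems(3)] by blast
        then obtain z where z: "z \<in> K" "(v, z) \<notin> A" "(z, v) \<notin> A"
          using symD[OF less.prems(3)] by blast
        have "deg A v K = deg A v (K - {z})"
          unfolding deg_def using z by (intro arg_cong2[of _ _ _ _ "(+)"] arg_cong[of _ _ card]) auto
        also have "\<dots> \<le> 2 * card (K - {z})" by (rule deg_le) (use fK in auto)
        also have "\<dots> = 2 * r" using K z fK by simp
        finally show ?thesis .
      qed
      have aK: "arcs_in A K \<le> Suc r * r"
      proof -
        have "card (A \<inter> K \<times> K) \<le> card (SIGMA x:K. K - {x})"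
          by (rule card_mono) (use fK less.prems(2) in \<open>auto simp: irrefl_def\<close>)
        also have "\<dots> = (\<Sum>x\<in>K. card (K - {x}))" using fK by simp
        also have "\<dots> = Suc r * r" using K(2) fK by simp
        finally show ?thesis by (simp add: arcs_in_def)
      qed
      have ih: "real (Suc r) * real (arcs_in A (V - K)) \<le> (real (Suc r) - 1) * (real (card (V - K)))\<^sup>2"
      proof (rule less.hyps)
        show "card (V - K) < card V" using cVK cV by simp
        show "\<exists>x\<in>L. \<exists>y\<in>L. x \<noteq> y \<and> (x, y) \<notin> A" if "L \<subseteq> V - K" "card L = Suc (Suc r)" for L
          using less.prems(4)[of L] that by blast
      qed (use less.prems in auto)
      have "(\<Sum>v\<in>V - K. deg A v K) \<le> (\<Sum>v\<in>V - K. 2 * r)" by (intro sum_mono dg)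
      hence "arcs_in A V \<le> arcs_in A (V - K) + Suc r * r + (card V - Suc r) * (2 * r)"
        using arcs_in_split[OF less.prems(1) K(1), of A] aK cVK by simp
      hence "real (arcs_in A V) \<le> real (arcs_in A (V - K) + Suc r * r + (card V - Suc r) * (2 * r))"
        by (simp only: of_nat_le_iff)
      also have "\<dots> = real (arcs_in A (V - K)) + (real r + 1) * real r
          + (real (card V) - (real r + 1)) * (2 * real r)"
        using cV by (simp only: of_nat_add of_nat_mult of_nat_diff of_nat_Suc of_nat_numeral add.commute)
      finally have 1: "real (arcs_in A V) \<le> real (arcs_in A (V - K)) + (real r + 1) * real r
          + (real (card V) - (real r + 1)) * (2 * real r)" .
      have 2: "(real r + 1) * real (arcs_in A (V - K)) \<le> real r * (real (card V) - (real r + 1))\<^sup>2"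
        using ih cV by (simp only: cVK of_nat_diff of_nat_Suc) (simp add: add.commute)
      from turan_step_arith[OF _ 1 2] show ?thesis by (simp add: add.commute)
    qed
  qed
qed

text \<open>A vertex of in-degree at most k also has out-degree at most k, and deleting it removes
  at most 2k arcs. If no such vertex exists, every path on at most k vertices extends at its head,
  because the head has more than k in-neighbours, and a path on k+1 vertices results.\<close>

lemma symmetric_path_bounded_arcs:
  assumes "finite V" "irrefl A" "sym A" "path_bounded A k V"
  shows "arcs_in A V \<le> 2 * k * card V"
  using assms
proof (induction "card V" arbitrary: V rule: less_induct)
  case less
  show ?case
  proof (cases "\<exists>v\<in>V. card {x \<in> V. (x, v) \<in> A} \<le> k")
    case True
    then obtain v where v: "v \<in> V" "card {x \<in> V. (x, v) \<in> A} \<le> k" by blast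
    have "{x \<in> V. (v, x) \<in> A} = {x \<in> V. (x, v) \<in> A}" using symD[OF less.prems(3)] by blast
    hence d: "deg A v V \<le> 2 * k" using v by (simp add: deg_def)
    have c: "card V = Suc (card (V - {v}))" using v less.prems(1) by (metis card_Suc_Diff1)
    have "arcs_in A (V - {v}) \<le> 2 * k * card (V - {v})"
      by (rule less.hyps) (use c less.prems path_bounded_mono[of A k V "V - {v}"] in auto)
    thus ?thesis
      using arcs_in_remove[OF less.prems(1) v(1) less.prems(2)] d c
      by (simp add: deg_remove_self[OF less.prems(2)])
  next
    case False
    show ?thesis
    proof (cases "V = {}")
      case True
      thus ?thesis by (simp add: arcs_in_def)
    next
      case ne: False
      have "\<exists>p. dipath A p \<and> set p \<subseteq> V \<and> length p = Suc j" if "j \<le> k" for j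
        using that
      proof (induction j)
        case 0
        from ne obtain v where "v \<in> V" by blast
        thus ?case by (intro exI[of _ "[v]"]) (auto simp: dipath_def)
      next
        case (Suc j)
        then obtain p where p: "dipath A p" "set p \<subseteq> V" "length p = Suc j" by auto
        have hd: "hd p \<in> V" using p by (metis Zero_not_Suc hd_in_set list.size(3) subsetD)
        have "card (set p) < card {x \<in> V. (x, hd p) \<in> A}"
        proof -
          have "card (set p) \<le> k" using p(3) Suc.prems card_length[of p] by linarith
          moreover have "k < card {x \<in> V. (x, hd p) \<in> A}" using False hd by (meson not_le)
          ultimately show ?thesis by linarith
        qed
        hence "\<not> {x \<in> V. (x, hd p) \<in> A} \<subseteq> set p" by (metis List.finite_set card_mono not_le)
        then obtain x where x: "x \<in> V" "(x, hd p) \<in> A" "x \<notin> set p" by blast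
        thus ?case using p
          by (intro exI[of _ "x # p"]) (auto simp: dipath_def successively_Cons)
      qed
      then obtain p where "dipath A p" "set p \<subseteq> V" "length p = Suc k" by blast
      hence False using less.prems(4) unfolding path_bounded_def by fastforce
      thus ?thesis ..
    qed
  qed
qed

text \<open>The clause on \<open>hd q\<close> strengthens the induction: after inserting x into the
  tail, the old first vertex a must still have an arc to the new head, which is either x or the old
  head of the tail.\<close>

lemma tournament_insert_path:
  assumes "dipath E p" "x \<notin> set p" "\<And>y. y \<in> set p \<Longrightarrow> (x, y) \<in> E \<or> (y, x) \<in> E"
  shows "\<exists>q. dipath E q \<and> set q = insert x (set p) \<and> (hd q = x \<or> p \<noteq> [] \<and> hd q = hd p)"
  using assms
proof (induction p)
  case Nil
  show ?case by (intro exI[of _ "[x]"]) (auto simp: dipath_def)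
next
  case (Cons a p)
  show ?case
  proof (cases "(x, a) \<in> E")
    case True
    thus ?thesis using Cons.prems
      by (intro exI[of _ "x # a # p"]) (auto simp: dipath_def)
  next
    case False
    hence ax: "(a, x) \<in> E" using Cons.prems(3) by auto
    have "dipath E p" using Cons.prems(1) by (auto simp: dipath_def successively_Cons)
    then obtain q where q: "dipath E q" "set q = insert x (set p)" "hd q = x \<or> p \<noteq> [] \<and> hd q = hd p"
      using Cons.IH[OF _ _ Cons.prems(3)] Cons.prems(2) by auto
    have "(a, hd q) \<in> E" using q(3) ax Cons.prems(1) by (auto simp: dipath_def successively_Cons)
    thus ?thesis using q Cons.prems
      by (intro exI[of _ "a # q"]) (auto simp: dipath_def successively_Cons)
  qed
qed

text \<open>Redei's theorem, with opposite arcs permitted.\<close>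

lemma tournament_hamiltonian_path:
  assumes "finite K" "\<And>x y. x \<in> K \<Longrightarrow> y \<in> K \<Longrightarrow> x \<noteq> y \<Longrightarrow> (x, y) \<in> E \<or> (y, x) \<in> E"
  shows "\<exists>p. dipath E p \<and> set p = K"
  using assms
proof (induction K rule: finite_induct)
  case empty
  show ?case by (intro exI[of _ "[]"]) (auto simp: dipath_def)
next
  case (insert x K)
  then obtain p where p: "dipath E p" "set p = K" by auto
  have "\<exists>q. dipath E q \<and> set q = insert x (set p) \<and> (hd q = x \<or> p \<noteq> [] \<and> hd q = hd p)"
    by (rule tournament_insert_path) (use p insert.hyps insert.prems in auto)
  thus ?case using p(2) by blast
qed

section \<open>Vertices attached to a longest path\<close>

text \<open>The index j counts the path vertices placed before v: j = 0 prepends, j =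
  \<open>length p\<close> appends, and the disjunctions stand for the neighbour missing
  there.\<close>

lemma insert_dipath:
  assumes "dipath E p" "v \<notin> set p" "j \<le> length p"
    and "j = 0 \<or> (p ! (j - 1), v) \<in> E" "j = length p \<or> (v, p ! j) \<in> E"
  shows "dipath E (take j p @ v # drop j p)"
proof -
  have "distinct (take j p @ drop j p)" using assms(1) by (simp add: dipath_def)
  hence d: "distinct (take j p @ v # drop j p)"
    using assms(2) set_take_disj_set_drop_if_distinct[of p j j]
    by (auto dest: in_set_takeD in_set_dropD)
  have "successively (\<lambda>x y. (x, y) \<in> E) (take j p)" "successively (\<lambda>x y. (x, y) \<in> E) (drop j p)"
    using assms(1) by (metis append_take_drop_id dipath_def successively_append_iff)+
  moreover have "last (take j p) = p ! (j - 1)" if "take j p \<noteq> []"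
    using that assms(3) by (subst last_conv_nth) auto
  moreover have "hd (drop j p) = p ! j" if "j < length p"
    using that by (simp add: hd_drop_conv_nth)
  ultimately show ?thesis
    using assms(3-5) d
    by (auto simp: dipath_def successively_append_iff successively_Cons)
qed

lemma deg_list:
  assumes "distinct p"
  shows "deg E v (set p) = card {i. i < length p \<and> (p ! i, v) \<in> E} + card {i. i < length p \<and> (v, p ! i) \<in> E}"
proof -
  have *: "card {x \<in> set p. P x} = card {i. i < length p \<and> P (p ! i)}" for P
  proof -
    have "{x \<in> set p. P x} = (!) p ` {i. i < length p \<and> P (p ! i)}"
      by (auto simp: in_set_conv_nth)
    thus ?thesis using assms by (simp add: card_image inj_on_def nth_eq_iff_index_eq)
  qed
  show ?thesis unfolding deg_def * ..
qed

context
  fixes E :: "('a \<times> 'a) set" and k V p v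
  assumes pb: "path_bounded E k V" and p: "dipath E p" "set p \<subseteq> V" "length p = k"
    and v: "v \<in> V" "v \<notin> set p" and k: "k \<ge> 1"
begin

text \<open>The path p already has the maximum number k of vertices. All restrictions on the arcs
  between v and p are instances of this one.\<close>

lemma no_insertion:
  assumes "j \<le> k" "j = 0 \<or> (p ! (j - 1), v) \<in> E" "j = k \<or> (v, p ! j) \<in> E"
  shows False
proof -
  have "dipath E (take j p @ v # drop j p)"
    using insert_dipath[OF p(1) v(2), of j] assms p(3) by simp
  moreover have "set (take j p @ v # drop j p) \<subseteq> V"
    using p(2) v(1) by (auto dest: in_set_takeD in_set_dropD)
  ultimately have "length (take j p @ v # drop j p) \<le> k" using pb unfolding path_bounded_def by blast
  thus False using p(3) assms(1) by simp
qed

lemma attach_consecutive: "Suc i < k \<Longrightarrow> (p ! i, v) \<in> E \<Longrightarrow> (v, p ! Suc i) \<notin> E"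
  using no_insertion[of "Suc i"] by auto

lemma attach_last: "(p ! (k - 1), v) \<notin> E"
  using no_insertion[of k] k by auto

lemma attach_first: "(v, p ! 0) \<notin> E"
  using no_insertion[of 0] by auto

text \<open>The path has k-1 gaps between consecutive vertices. Charge an arc from p_i to v, and an
  arc from v to p_{i+1}, to gap i. The end conditions leave no arc uncharged, and a gap charged
  twice would admit an insertion. Equality means that every gap is charged.\<close>

lemma attach_deg:
  shows "deg E v (set p) \<le> k - 1"
    and "deg E v (set p) = k - 1 \<Longrightarrow> Suc i < k \<Longrightarrow> (p ! i, v) \<in> E \<or> (v, p ! Suc i) \<in> E"
proof -
  define I where "I = {i. i < k \<and> (p ! i, v) \<in> E}"
  define J where "J = {i. Suc i < k \<and> (v, p ! Suc i) \<in> E}"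
  have fin: "finite I" "finite J" by (auto simp: I_def J_def intro: finite_subset[of _ "{..<k}"])
  have "{i. i < k \<and> (v, p ! i) \<in> E} = Suc ` J"
  proof -
    have "i \<in> Suc ` J" if "i < k" "(v, p ! i) \<in> E" for i
      using that attach_first by (cases i) (auto simp: J_def)
    thus ?thesis by (auto simp: J_def)
  qed
  hence "card {i. i < k \<and> (v, p ! i) \<in> E} = card J" by (simp add: card_image)
  hence "deg E v (set p) = card I + card J"
    using deg_list[of p E v] p by (simp add: dipath_def I_def)
  also have "\<dots> = card (I \<union> J)"
    using fin attach_consecutive by (subst card_Un_disjoint) (auto simp: I_def J_def)
  finally have d: "deg E v (set p) = card (I \<union> J)" .
  have sub: "I \<union> J \<subseteq> {..<k - 1}"
  proof -
    have "i \<noteq> k - 1" if "i \<in> I" for i using that attach_last by (auto simp: I_def)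
    thus ?thesis by (force simp: I_def J_def)
  qed
  show "deg E v (set p) \<le> k - 1" unfolding d using card_mono[OF _ sub] by simp
  assume "deg E v (set p) = k - 1" "Suc i < k"
  moreover from this have "I \<union> J = {..<k - 1}" using d card_subset_eq[OF _ sub] by simp
  ultimately have "i \<in> I \<union> J" by simp
  thus "(p ! i, v) \<in> E \<or> (v, p ! Suc i) \<in> E" by (auto simp: I_def J_def)
qed

text \<open>Let p_m be the first path vertex without an arc to v. Gap m must then be charged by an
  arc from v to p_{m+1}; as there are no opposite arcs, p_{m+1} sends none to v either, and this
  propagates to the end. So v is joined to the path as a twin of p_m in a transitive
  tournament.\<close>

lemma attach_type:
  assumes "deg E v (set p) = k - 1" and "\<And>x. x \<in> set p \<Longrightarrow> (x, v) \<in> E \<Longrightarrow> (v, x) \<notin> E"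
  shows "\<exists>m<k. (\<forall>i<k. ((p ! i, v) \<in> E \<longleftrightarrow> i < m) \<and> ((v, p ! i) \<in> E \<longleftrightarrow> m < i))"
proof -
  define m where "m = (LEAST i. (p ! i, v) \<notin> E)"
  have mk: "m \<le> k - 1" unfolding m_def by (rule Least_le) (rule attach_last)
  have m: "(p ! m, v) \<notin> E" unfolding m_def by (rule LeastI) (rule attach_last)
  have lt: "(p ! i, v) \<in> E" if "i < m" for i using not_less_Least[OF that[unfolded m_def]] by simp
  have ge: "(p ! i, v) \<notin> E" if "m \<le> i" "i < k" for i
    using that
  proof (induction rule: dec_induct)
    case base
    show ?case by (rule m)
  next
    case (step i)
    hence "(v, p ! Suc i) \<in> E" using attach_deg(2)[OF assms(1), of i] by auto
    thus ?case using assms(2)[of "p ! Suc i"] step.prems p(3) nth_mem by blast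
  qed
  have out: "(v, p ! i) \<in> E \<longleftrightarrow> m < i" if "i < k" for i
  proof (cases i)
    case 0
    thus ?thesis using attach_first by simp
  next
    case (Suc j)
    thus ?thesis using attach_consecutive[of j] attach_deg(2)[OF assms(1), of j] lt[of j] ge[of j] that
      by (cases "j < m") auto
  qed
  have "(p ! i, v) \<in> E \<longleftrightarrow> i < m" if "i < k" for i
    using lt[of i] ge[of i] that by (cases "i < m") auto
  with out mk k show ?thesis by (intro exI[of _ m]) auto
qed

end

text \<open>The contradiction reached if no suitable path exists: $e$ counts all arcs, $h$ the vertices on more
  than $T$ pairs of opposite arcs, and $a/2$ the remaining unpaired arcs.\<close>

lemma exists_path_arith:
  fixes k n e h a T :: real
  assumes "k \<ge> 2" "T = 16 * k ^ 3" "n \<ge> 8 * k ^ 3 + 2" "h \<ge> 0"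
    and "e \<ge> (k - 1) / (2 * k) * n\<^sup>2 - k"
    and "T * h \<le> 2 * k * n"
    and "a \<ge> 2 * (e - 2 * k * n - 2 * h * n)"
    and "(k - 1) * a \<le> (k - 2) * n\<^sup>2"
  shows False
proof -
  have k3: "k ^ 3 = k * k * k" by (simp add: power3_eq_cube)
  have kp: "k > 0" using assms by simp
  have n0: "n > 0" using assms(3) kp by (smt (verit) zero_less_power)
  \<comment> \<open>The value of \<open>T\<close> is chosen here: it makes h small enough that the
    loss caused by heavy vertices absorbs at most half of the n^2 gained below.\<close>
  have "8 * k\<^sup>2 * h \<le> n"
  proof -
    have "(2 * k) * (8 * k\<^sup>2 * h) \<le> (2 * k) * n"
      using assms(6) unfolding assms(2) k3 by (simp add: power2_eq_square algebra_simps)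
    thus ?thesis using kp by (simp only: mult_le_cancel_left_pos[of "2 * k"])
  qed
  hence hn: "8 * k\<^sup>2 * h * n \<le> n\<^sup>2"
    using n0 by (simp add: power2_eq_square)
  have "(k - 1) * (2 * (e - 2 * k * n - 2 * h * n)) \<le> (k - 2) * n\<^sup>2"
    using mult_left_mono[OF assms(7), of "k - 1"] assms(1,8) by linarith
  hence "(k - 1) * (2 * ((k - 1) / (2 * k) * n\<^sup>2 - k - 2 * k * n - 2 * h * n)) \<le> (k - 2) * n\<^sup>2"
    by (rule order_trans[rotated], intro mult_left_mono) (use assms(1,5) in auto)
  hence "k * ((k - 1) * (2 * ((k - 1) / (2 * k) * n\<^sup>2 - k - 2 * k * n - 2 * h * n))) \<le> k * ((k - 2) * n\<^sup>2)"
    using kp by (intro mult_left_mono) auto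
  moreover have "k * ((k - 1) * (2 * ((k - 1) / (2 * k) * n\<^sup>2 - k - 2 * k * n - 2 * h * n)))
     = (k - 1)\<^sup>2 * n\<^sup>2 - k * (k - 1) * (2 * k + 4 * k * n + 4 * h * n)"
    using kp by (simp add: field_simps power2_eq_square)
  \<comment> \<open>Cleared of denominators, the gap between the Turan densities (k-1)/(2k) and
    (k-2)/(2(k-1)) is exactly n^2.\<close>
  moreover have "(k - 1)\<^sup>2 * n\<^sup>2 - k * ((k - 2) * n\<^sup>2) = n\<^sup>2"
    by (simp add: algebra_simps power2_eq_square)
  ultimately have 1: "n\<^sup>2 \<le> k * (k - 1) * (2 * k + 4 * k * n + 4 * h * n)" by linarith
  also have "\<dots> \<le> k * k * (2 * k + 4 * k * n + 4 * h * n)"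
    using kp n0 assms(4) by (intro mult_right_mono) auto
  also have "\<dots> = 2 * k ^ 3 + 4 * k ^ 3 * n + (8 * k\<^sup>2 * h * n) / 2"
    by (simp add: k3 power2_eq_square algebra_simps)
  also have "\<dots> \<le> 2 * k ^ 3 + 4 * k ^ 3 * n + n\<^sup>2 / 2" using hn by (intro add_left_mono divide_right_mono) auto
  finally have 2: "n\<^sup>2 \<le> 4 * k ^ 3 + 8 * k ^ 3 * n" by simp
  have "(8 * k ^ 3 + 2) * n \<le> n * n" using assms(3) n0 by (intro mult_right_mono) auto
  hence "2 * n \<le> 4 * k ^ 3" using 2 by (simp add: power2_eq_square algebra_simps)
  moreover have "k ^ 3 > 0" using kp by simp
  ultimately show False using assms(3) by linarith
qed

text \<open>After the arcs of \<open>B\<close> and all arcs at \<open>H\<close> are discarded, the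
  symmetric closure \<open>A\<close> still exceeds the Turan bound for k-cliques. A k-clique of
  \<open>A\<close> induces a tournament in \<open>E\<close>, and Redei's theorem orders it into a
  path. Avoiding \<open>H\<close> is what keeps the opposite pairs at each path vertex bounded, so
  that few vertices become exceptional later.\<close>

lemma exists_tournament_path_ge_2:
  fixes E :: "('a \<times> 'a) set"
  assumes k: "k \<ge> 2" and V: "finite V" and E: "irrefl E" "path_bounded E k V"
    and n: "8 * k ^ 3 + 2 \<le> card V"
    and e: "real (arcs_in E V) \<ge> (real k - 1) / (2 * real k) * (real (card V))\<^sup>2 - real k"
  shows "\<exists>p. dipath E p \<and> set p \<subseteq> V \<and> length p = k \<and> 2 * arcs_in E (set p) \<le> k * (k - 1) \<and>
      (\<forall>x\<in>set p. card {u \<in> V. (u, x) \<in> E \<and> (x, u) \<in> E} \<le> 16 * k ^ 3)"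
proof (rule ccontr)
  assume contr: "\<not> ?thesis"
  define T where "T = 16 * k ^ 3"
  define B where "B = {(u, v). (u, v) \<in> E \<and> (v, u) \<in> E}"
  define b where "b x = card {u \<in> V. (x, u) \<in> B}" for x
  define H where "H = {x \<in> V. b x > T}"
  define E' where "E' = {(u, v). u \<in> V - H \<and> v \<in> V - H \<and> (u, v) \<in> E \<and> (v, u) \<notin> E}"
  define A where "A = E' \<union> E'\<inverse>"
  have H: "finite H" "H \<subseteq> V" using V by (auto simp: H_def)
  have Bpb: "path_bounded B k V"
    unfolding path_bounded_def
  proof (intro allI impI)
    fix p assume "dipath B p" "set p \<subseteq> V"
    moreover from this have "dipath E p"
      by (auto simp: dipath_def B_def elim: successively_mono)
    ultimately show "length p \<le> k" using E(2) by (auto simp: path_bounded_def)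
  qed
  have "irrefl B" "sym B" using E(1) by (auto simp: B_def irrefl_def sym_def)
  from symmetric_path_bounded_arcs[OF V this Bpb] have cB: "arcs_in B V \<le> 2 * k * card V" .
  have "arcs_in B V = (\<Sum>x\<in>V. b x)"
  proof -
    have "B \<inter> V \<times> V = {(x, u). x \<in> V \<and> u \<in> V \<and> (x, u) \<in> B}" by auto
    thus ?thesis using card_pairs_eq_sum[OF V V, of "\<lambda>x u. (x, u) \<in> B"] by (simp add: arcs_in_def b_def)
  qed
  moreover have "(\<Sum>x\<in>H. T) \<le> (\<Sum>x\<in>H. b x)" by (intro sum_mono) (auto simp: H_def)
  moreover have "(\<Sum>x\<in>H. b x) \<le> (\<Sum>x\<in>V. b x)" by (intro sum_mono2) (use V H in auto)
  ultimately have TH: "T * card H \<le> 2 * k * card V" using cB by (simp add: mult.commute)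
  have "E \<inter> V \<times> V \<subseteq> E' \<union> (B \<inter> V \<times> V) \<union> H \<times> V \<union> V \<times> H"
    by (auto simp: E'_def B_def)
  hence "arcs_in E V \<le> card (E' \<union> (B \<inter> V \<times> V) \<union> H \<times> V \<union> V \<times> H)"
    unfolding arcs_in_def by (intro card_mono) (use V H in \<open>auto simp: E'_def intro: finite_subset[of _ "V \<times> V"]\<close>)
  also have "\<dots> \<le> card E' + card (B \<inter> V \<times> V) + card (H \<times> V) + card (V \<times> H)"
    by (intro order_trans[OF card_Un_le] add_mono order_refl)
  finally have eE': "arcs_in E V \<le> card E' + arcs_in B V + 2 * card H * card V"
    by (simp add: arcs_in_def card_cartesian_product algebra_simps)
  have fE': "finite E'" using V by (auto simp: E'_def intro: finite_subset[of _ "V \<times> V"])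
  have "arcs_in A V = card A"
    unfolding arcs_in_def by (rule arg_cong[of _ _ card]) (auto simp: A_def E'_def)
  also have "\<dots> = card E' + card (E'\<inverse>)"
    unfolding A_def by (rule card_Un_disjoint) (use fE' in \<open>auto simp: E'_def\<close>)
  also have "\<dots> = 2 * card E'" by simp
  finally have cA: "arcs_in A V = 2 * card E'" .
  have "irrefl A" "sym A" using E(1) by (auto simp: A_def E'_def irrefl_def sym_def)
  have "real (k - 1) * real (arcs_in A V) \<le> (real (k - 1) - 1) * (real (card V))\<^sup>2"
  proof (rule turan_weak[OF V \<open>irrefl A\<close> \<open>sym A\<close>])
    fix K assume K: "K \<subseteq> V" "card K = Suc (k - 1)"
    show "\<exists>x\<in>K. \<exists>y\<in>K. x \<noteq> y \<and> (x, y) \<notin> A"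
    proof (rule ccontr)
      assume "\<not> ?thesis"
      hence cl: "\<And>x y. x \<in> K \<Longrightarrow> y \<in> K \<Longrightarrow> x \<noteq> y \<Longrightarrow> (x, y) \<in> A" by blast
      have fK: "finite K" using K(1) V finite_subset by blast
      have cK: "card K = k" using K(2) k by simp
      have "\<exists>p. dipath E p \<and> set p = K"
        by (rule tournament_hamiltonian_path[OF fK]) (use cl in \<open>auto simp: A_def E'_def\<close>)
      then obtain p where p: "dipath E p" "set p = K" by blast
      have lp: "length p = k" using p cK distinct_card[of p] by (simp add: dipath_def)
      have deg: "card {u \<in> V. (u, x) \<in> E \<and> (x, u) \<in> E} \<le> T" if x: "x \<in> K" for x
      proof -
        \<comment> \<open>Membership in \<open>V - H\<close> is read off from an arc of
          \<open>A\<close> at x, so a second vertex of \<open>K\<close> is required.\<close>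
        have "\<not> K \<subseteq> {x}" using cK k card_mono[of "{x}" K] by auto
        then obtain y where "y \<in> K" "x \<noteq> y" by blast
        hence "x \<in> V - H" using cl[OF x] by (auto simp: A_def E'_def)
        hence "b x \<le> T" by (auto simp: H_def)
        moreover have "{u \<in> V. (u, x) \<in> E \<and> (x, u) \<in> E} = {u \<in> V. (x, u) \<in> B}"
          by (auto simp: B_def)
        ultimately show ?thesis by (simp add: b_def)
      qed
      have "2 * arcs_in E K \<le> k * (k - 1)"
      proof -
        let ?F = "E \<inter> K \<times> K"
        have fF: "finite ?F" using fK by blast
        have as: "(y, x) \<notin> E" if "(x, y) \<in> ?F" for x y
        proof -
          have "x \<noteq> y" using that E(1) by (auto simp: irrefl_def)
          hence "(x, y) \<in> A" using that cl by blast
          thus ?thesis using that by (auto simp: A_def E'_def)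
        qed
        have "2 * arcs_in E K = card ?F + card (?F\<inverse>)" by (simp add: arcs_in_def)
        also have "\<dots> = card (?F \<union> ?F\<inverse>)"
          by (rule card_Un_disjoint[symmetric]) (use fF as in auto)
        also have "\<dots> \<le> card (SIGMA x:K. K - {x})"
          by (rule card_mono) (use fK E(1) in \<open>auto simp: irrefl_def\<close>)
        also have "\<dots> = (\<Sum>x\<in>K. card (K - {x}))" using fK by simp
        also have "\<dots> = k * (k - 1)" using cK fK by simp
        finally show ?thesis .
      qed
      with p lp deg K(1) contr show False unfolding T_def by blast
    qed
  qed
  hence "(real k - 1) * real (arcs_in A V) \<le> (real k - 2) * (real (card V))\<^sup>2"
    using k by (simp add: of_nat_diff)
  moreover have "real (arcs_in A V) \<ge> 2 * (real (arcs_in E V) - 2 * real k * real (card V) - 2 * real (card H) * real (card V))"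
  proof -
    have "real (arcs_in E V) \<le> real (card E' + 2 * k * card V + 2 * card H * card V)"
      using eE' cB by (simp only: of_nat_le_iff)
    thus ?thesis unfolding cA by simp
  qed
  moreover have "(16 * real k ^ 3) * real (card H) \<le> 2 * real k * real (card V)"
    using TH unfolding T_def by (metis (mono_tags) of_nat_le_iff of_nat_mult of_nat_numeral of_nat_power)
  moreover have "8 * real k ^ 3 + 2 \<le> real (card V)"
    using n by (metis (mono_tags) of_nat_add of_nat_le_iff of_nat_mult of_nat_numeral of_nat_power)
  ultimately show False
    using exists_path_arith[of "real k" "16 * real k ^ 3" "real (card V)" "real (card H)" "real (arcs_in E V)" "real (arcs_in A V)"]
      k e by simp
qed

text \<open>For k = 1 there are no arcs inside V, and any single vertex serves.\<close>

lemma exists_tournament_path: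
  fixes E :: "('a \<times> 'a) set"
  assumes k: "k \<ge> 1" and V: "finite V" and E: "irrefl E" "path_bounded E k V"
    and n: "8 * k ^ 3 + 2 \<le> card V"
    and e: "real (arcs_in E V) \<ge> (real k - 1) / (2 * real k) * (real (card V))\<^sup>2 - real k"
  shows "\<exists>p. dipath E p \<and> set p \<subseteq> V \<and> length p = k \<and> 2 * arcs_in E (set p) \<le> k * (k - 1) \<and>
      (\<forall>x\<in>set p. card {u \<in> V. (u, x) \<in> E \<and> (x, u) \<in> E} \<le> 16 * k ^ 3)"
proof (cases "k = 1")
  case True
  from n have "V \<noteq> {}" by auto
  then obtain x where x: "x \<in> V" by blast
  have "(u, x) \<notin> E" if "u \<in> V" for u
  proof
    assume ux: "(u, x) \<in> E"
    hence "dipath E [u, x]" using E(1) by (auto simp: dipath_def irrefl_def)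
    hence "length [u, x] \<le> k" using E(2) that x unfolding path_bounded_def
      by (metis empty_set empty_subsetI insert_subset list.simps(15))
    thus False using True by simp
  qed
  hence "{u \<in> V. (u, x) \<in> E \<and> (x, u) \<in> E} = {}" by blast
  hence "card {u \<in> V. (u, x) \<in> E \<and> (x, u) \<in> E} = 0" by (simp only: card.empty)
  thus ?thesis using True x arcs_in_singleton[OF E(1), of x]
    by (intro exI[of _ "[x]"]) (simp add: dipath_def)
next
  case False
  with k show ?thesis using exists_tournament_path_ge_2[OF _ V E n e] by simp
qed

section \<open>The arc bound up to a constant, and the minimum degree it forces\<close>

lemma path_bounded_arcs_le:
  fixes E :: "('a \<times> 'a) set"
  assumes k: "k \<ge> 1" and V: "finite V" and E: "irrefl E" "path_bounded E k V"
  shows "real (arcs_in E V) \<le> (real k - 1) / (2 * real k) * (real (card V))\<^sup>2 + (8 * real k ^ 3 + 2)\<^sup>2"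
  using V E(2)
proof (induction "card V" arbitrary: V rule: less_induct)
  case less
  let ?n = "real (card V)"
  have g0: "(real k - 1) / (2 * real k) * ?n\<^sup>2 \<ge> 0" using k by simp
  show ?case
  proof (cases "8 * k ^ 3 + 2 \<le> card V")
    case False
    \<comment> \<open>The additive constant arises only here, from the trivial bound |V|^2 for small
      vertex sets.\<close>
    hence "card V \<le> 8 * k ^ 3 + 2" by simp
    hence "?n \<le> real (8 * k ^ 3 + 2)" by (simp only: of_nat_le_iff)
    hence "?n \<le> 8 * real k ^ 3 + 2" by simp
    moreover have "real (arcs_in E V) \<le> ?n * ?n"
      using arcs_in_le[OF less.prems(1), of E] by (metis of_nat_le_iff of_nat_mult)
    moreover have "?n * ?n \<le> (8 * real k ^ 3 + 2) * (8 * real k ^ 3 + 2)"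
      using calculation(1) by (intro mult_mono) auto
    ultimately show ?thesis using g0 unfolding power2_eq_square by linarith
  next
    case True
    show ?thesis
    proof (cases "real (arcs_in E V) \<ge> (real k - 1) / (2 * real k) * ?n\<^sup>2 - real k")
      case False
      have "(8 * real k ^ 3 + 2)\<^sup>2 \<ge> 0" by simp
      with False show ?thesis by linarith
    next
      case e: True
      from exists_tournament_path[OF k less.prems(1) E(1) less.prems(2) True e]
      obtain p where p: "dipath E p" "set p \<subseteq> V" "length p = k" "2 * arcs_in E (set p) \<le> k * (k - 1)"
        by blast
      let ?S = "set p"
      have cS: "card ?S = k" using p(1,3) distinct_card by (auto simp: dipath_def)
      have kn: "k \<le> card V" using cS p(2) less.prems(1) card_mono by metis
      have c: "card (V - ?S) = card V - k" using p(2) cS by (simp add: card_Diff_subset)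
      have ih: "real (arcs_in E (V - ?S)) \<le> (real k - 1) / (2 * real k) * (real (card (V - ?S)))\<^sup>2 + (8 * real k ^ 3 + 2)\<^sup>2"
        by (rule less.hyps) (use c k kn less.prems path_bounded_mono[of E k V "V - ?S"] in auto)
      have "(\<Sum>v\<in>V - ?S. deg E v ?S) \<le> (\<Sum>v\<in>V - ?S. k - 1)"
        by (intro sum_mono attach_deg(1)[OF less.prems(2) p(1-3)]) (use k in auto)
      hence "arcs_in E V \<le> arcs_in E (V - ?S) + arcs_in E ?S + (card V - k) * (k - 1)"
        using arcs_in_split[OF less.prems(1) p(2), of E] c by simp
      hence "real (arcs_in E V) \<le> real (arcs_in E (V - ?S) + arcs_in E ?S + (card V - k) * (k - 1))"
        by (simp only: of_nat_le_iff)
      also have "\<dots> = real (arcs_in E (V - ?S)) + real (arcs_in E ?S) + (?n - real k) * (real k - 1)"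
        using kn k by (simp add: of_nat_diff)
      finally have 1: "real (arcs_in E V) \<le> real (arcs_in E (V - ?S)) + real (arcs_in E ?S) + (?n - real k) * (real k - 1)" .
      have "real (2 * arcs_in E ?S) \<le> real (k * (k - 1))" using p(4) by (simp only: of_nat_le_iff)
      hence 2: "real (arcs_in E ?S) \<le> real k * (real k - 1) / 2" using k by (simp add: of_nat_diff)
      \<comment> \<open>The main term decreases by exactly what deleting the path can remove, so the
        constant passes unchanged through the induction.\<close>
      have 3: "(real k - 1) / (2 * real k) * (?n - real k)\<^sup>2 + real k * (real k - 1) / 2 + (?n - real k) * (real k - 1)
          = (real k - 1) / (2 * real k) * ?n\<^sup>2"
        using k by (simp add: field_simps power2_eq_square)
      show ?thesis using 1 2 3 ih c kn by (simp add: of_nat_diff)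
    qed
  qed
qed

text \<open>Deleting a vertex of low degree would leave too many arcs on the remaining vertices for
  \<open>path_bounded_arcs_le\<close>. The final 1 covers (k-1)/(2k), the lower-order part of the
  difference of the two main terms.\<close>

lemma path_bounded_min_deg:
  assumes k: "k \<ge> 1" and V: "finite V" and E: "irrefl E" "path_bounded E k V"
    and e: "real (arcs_in E V) \<ge> (real k - 1) / (2 * real k) * (real (card V))\<^sup>2 - real k"
    and x: "x \<in> V"
  shows "real (deg E x V) \<ge> (real k - 1) / real k * real (card V) - ((8 * real k ^ 3 + 2)\<^sup>2 + real k + 1)"
proof -
  let ?n = "real (card V)"
  have c: "real (card (V - {x})) = ?n - 1" using V x
    by (simp add: of_nat_diff card_Diff_singleton Suc_leI card_gt_0_iff)
      (metis One_nat_def Suc_leI card_gt_0_iff empty_iff of_nat_1 of_nat_diff)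
  have "real (arcs_in E (V - {x})) \<le> (real k - 1) / (2 * real k) * (?n - 1)\<^sup>2 + (8 * real k ^ 3 + 2)\<^sup>2"
    using path_bounded_arcs_le[OF k _ E(1), of "V - {x}"] V c path_bounded_mono[OF E(2), of "V - {x}"] by auto
  moreover have "arcs_in E V = arcs_in E (V - {x}) + deg E x V"
    using arcs_in_remove[OF V x E(1)] deg_remove_self[OF E(1)] by metis
  moreover have "(real k - 1) / (2 * real k) * ?n\<^sup>2 - (real k - 1) / (2 * real k) * (?n - 1)\<^sup>2
     = (real k - 1) / real k * ?n - (real k - 1) / (2 * real k)"
    using k by (simp add: field_simps power2_eq_square)
  moreover have "(real k - 1) / (2 * real k) \<le> 1" using k by (simp add: field_simps)
  ultimately show ?thesis using e by simp
qed

section \<open>Digraphs with an almost complete forward partition\<close>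

text \<open>\<open>W\<close> holds the exceptional vertices, and \<open>Q\<close> absorbs every
  constant error. The inequalities are multiplied by k to stay in the naturals:
  \<open>min_deg\<close> says that degrees are at least (1 - 1/k)|V| - Q/k.\<close>

locale class_system =
  fixes E :: "('a \<times> 'a) set" and V W :: "'a set" and k Q :: nat and U :: "nat \<Rightarrow> 'a set"
  assumes k: "k \<ge> 1" and fin: "finite V" and irr: "irrefl E" and pb: "path_bounded E k V"
    and V_eq: "V = W \<union> (\<Union>i<k. U i)"
    and W_disj: "\<And>i. i < k \<Longrightarrow> W \<inter> U i = {}"
    and U_disj: "disjoint_family_on U {..<k}"
    and forward: "\<And>i j u w. i < k \<Longrightarrow> j < k \<Longrightarrow> u \<in> U i \<Longrightarrow> w \<in> U j \<Longrightarrow> (u, w) \<in> E \<Longrightarrow> i < j"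
    and min_deg: "\<And>x. x \<in> V \<Longrightarrow> k * card V \<le> k * deg E x V + card V + Q"
    and card_W: "2 * k * card W \<le> Q"
    and large: "k * (6 * Q + k + 4) < card V"
begin

section \<open>Sizes of the classes and degrees into them\<close>

lemma fin_W: "finite W" and fin_U: "i < k \<Longrightarrow> finite (U i)"
  using fin unfolding V_eq by (auto intro: finite_subset)

lemma U_sub: "i < k \<Longrightarrow> U i \<subseteq> V"
  unfolding V_eq by blast

lemma U_eq_index: "i < k \<Longrightarrow> j < k \<Longrightarrow> u \<in> U i \<Longrightarrow> u \<in> U j \<Longrightarrow> i = j"
  using U_disj by (auto simp: disjoint_family_on_def)

lemma card_V: "card V = card W + (\<Sum>i<k. card (U i))"
proof -
  have "card V = card W + card (\<Union>i<k. U i)"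
    unfolding V_eq by (rule card_Un_disjoint) (use fin_W fin_U W_disj in auto)
  also have "card (\<Union>i<k. U i) = (\<Sum>i<k. card (U i))"
    by (rule card_UN_disjoint') (use U_disj fin_U in auto)
  finally show ?thesis .
qed

lemma deg_V: "deg E x V = deg E x W + (\<Sum>i<k. deg E x (U i))"
proof -
  have "deg E x V = deg E x W + deg E x (\<Union>i<k. U i)"
    unfolding V_eq by (rule deg_Un) (use fin_W fin_U W_disj in auto)
  also have "deg E x (\<Union>i<k. U i) = (\<Sum>i<k. deg E x (U i))"
    by (rule deg_UN) (use U_disj fin_U in auto)
  finally show ?thesis .
qed

text \<open>Compared with |V| class by class, the degree of x loses all of \<open>U m\<close> and,
  in the second bound, also its shortfall in \<open>U l\<close>. Only on \<open>W\<close> may it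
  gain, where opposite arcs count twice.\<close>

lemma deg_missing:
  assumes "m < k" "deg E x (U m) = 0" "\<And>l. l < k \<Longrightarrow> deg E x (U l) \<le> card (U l)"
  shows "deg E x V + card (U m) \<le> 2 * card W + card V"
    and "l < k \<Longrightarrow> l \<noteq> m \<Longrightarrow>
      deg E x V + card (U m) + card (U l) \<le> 2 * card W + card V + deg E x (U l)"
proof -
  have W: "deg E x W \<le> 2 * card W" by (rule deg_le[OF fin_W])
  have s: "(\<Sum>i<k. f i) = f m + (\<Sum>i\<in>{..<k} - {m}. f i)" for f :: "nat \<Rightarrow> nat"
    by (rule sum.remove) (use assms in auto)
  have "(\<Sum>i\<in>{..<k} - {m}. deg E x (U i)) \<le> (\<Sum>i\<in>{..<k} - {m}. card (U i))"
    by (intro sum_mono assms) auto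
  thus "deg E x V + card (U m) \<le> 2 * card W + card V"
    using s[of "\<lambda>i. deg E x (U i)"] s[of "\<lambda>i. card (U i)"] deg_V[of x] card_V W assms(2) by linarith
  assume l: "l < k" "l \<noteq> m"
  have s2: "(\<Sum>i\<in>{..<k} - {m}. f i) = f l + (\<Sum>i\<in>{..<k} - {m} - {l}. f i)" for f :: "nat \<Rightarrow> nat"
    by (rule sum.remove) (use l in auto)
  have "(\<Sum>i\<in>{..<k} - {m} - {l}. deg E x (U i)) \<le> (\<Sum>i\<in>{..<k} - {m} - {l}. card (U i))"
    by (intro sum_mono assms) auto
  thus "deg E x V + card (U m) + card (U l) \<le> 2 * card W + card V + deg E x (U l)"
    using s[of "\<lambda>i. deg E x (U i)"] s[of "\<lambda>i. card (U i)"]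
      s2[of "\<lambda>i. deg E x (U i)"] s2[of "\<lambda>i. card (U i)"] deg_V[of x] card_V W assms(2) by linarith
qed

lemma no_arc_down: "u \<in> U i \<Longrightarrow> w \<in> U j \<Longrightarrow> i < k \<Longrightarrow> j < k \<Longrightarrow> j \<le> i \<Longrightarrow> (u, w) \<notin> E"
  using forward[of i j u w] by auto

lemma deg_class_up:
  assumes "u \<in> U i" "i \<le> l" "l < k"
  shows "deg E u (U l) = card {w \<in> U l. (u, w) \<in> E}"
proof -
  have "{w \<in> U l. (w, u) \<in> E} = {}" using assms no_arc_down[of _ l u i] by auto
  thus ?thesis by (simp only: deg_def card.empty)
qed

lemma deg_class_down:
  assumes "u \<in> U i" "l \<le> i" "i < k"
  shows "deg E u (U l) = card {w \<in> U l. (w, u) \<in> E}"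
proof -
  have "{w \<in> U l. (u, w) \<in> E} = {}" using assms no_arc_down[of u i _ l] by auto
  thus ?thesis by (simp only: deg_def card.empty)
qed

lemma deg_class_self:
  assumes "u \<in> U i" "i < k"
  shows "deg E u (U i) = 0"
proof -
  have "{w \<in> U i. (u, w) \<in> E} = {}" using assms no_arc_down[of u i _ i] by auto
  thus ?thesis using deg_class_up[of u i i] assms by (simp only: card.empty)
qed

lemma deg_class_le:
  assumes "u \<in> U i" "i < k" "l < k"
  shows "deg E u (U l) \<le> card (U l)"
proof (cases "i \<le> l")
  case True
  thus ?thesis using deg_class_up[of u i l] assms fin_U by (auto intro: card_mono)
next
  case False
  thus ?thesis using deg_class_down[of u i l] assms fin_U by (auto intro: card_mono)
qed

text \<open>A vertex of \<open>U i\<close> has no arc to its own class, so a class much larger than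
  |V|/k would violate the minimum degree.\<close>

lemma card_U_le:
  assumes "i < k"
  shows "k * card (U i) \<le> card V + 2 * Q"
proof (cases "U i = {}")
  case False
  then obtain u where u: "u \<in> U i" by blast
  have "deg E u V + card (U i) \<le> 2 * card W + card V"
    by (rule deg_missing(1)[OF assms deg_class_self[OF u assms] deg_class_le[OF u assms]])
  hence "k * (deg E u V + card (U i)) \<le> k * (2 * card W + card V)" by (rule mult_le_mono2)
  thus ?thesis using min_deg[of u] U_sub[OF assms] u card_W by (auto simp: algebra_simps)
qed simp

text \<open>The other k-1 classes are bounded above and \<open>W\<close> is small, so the rest of V
  must lie in \<open>U i\<close>.\<close>

lemma card_U_ge:
  assumes "i < k"
  shows "card V \<le> k * card (U i) + 2 * k * Q"
proof -
  have "(\<Sum>j<k. card (U j)) = card (U i) + (\<Sum>j\<in>{..<k} - {i}. card (U j))"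
    by (rule sum.remove) (use assms in auto)
  hence "k * card V = k * card W + k * card (U i) + (\<Sum>j\<in>{..<k} - {i}. k * card (U j))"
    unfolding card_V by (simp add: algebra_simps sum_distrib_left)
  also have "(\<Sum>j\<in>{..<k} - {i}. k * card (U j)) \<le> (\<Sum>j\<in>{..<k} - {i}. card V + 2 * Q)"
    by (intro sum_mono card_U_le) auto
  also have "\<dots> = (k - 1) * (card V + 2 * Q)" using assms by simp
  finally have 1: "k * card V \<le> k * card W + k * card (U i) + (k - 1) * (card V + 2 * Q)" by simp
  obtain k' where k': "k = Suc k'" using k by (cases k) auto
  show ?thesis using 1 card_W unfolding k' by (simp add: algebra_simps)
qed

text \<open>The margin k+3 beyond 4Q pays for the vertices that a prolonged path has to
  avoid.\<close>

lemma card_U_large: "i < k \<Longrightarrow> 4 * Q + k + 3 < card (U i)"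
proof -
  assume "i < k"
  hence "k * (6 * Q + k + 4) < k * card (U i) + 2 * k * Q"
    using large card_U_ge[of i] by linarith
  hence "k * (6 * Q + k + 4) < k * (card (U i) + 2 * Q)" by (simp add: algebra_simps)
  thus ?thesis by simp
qed

text \<open>Missing the class \<open>U m\<close>, of size about |V|/k, already uses up the
  deficiency that \<open>min_deg\<close> allows; the shortfall in any other class is therefore of
  order Q. The factor 4 comes from 2Q + 2kQ <= 4kQ.\<close>

lemma deg_class_ge:
  assumes "x \<in> V" "m < k" "deg E x (U m) = 0" "\<And>l. l < k \<Longrightarrow> deg E x (U l) \<le> card (U l)"
    and "l < k" "l \<noteq> m"
  shows "card (U l) \<le> deg E x (U l) + 4 * Q"
proof -
  have "k * (deg E x V + card (U m) + card (U l)) \<le> k * (2 * card W + card V + deg E x (U l))"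
    using deg_missing(2)[OF assms(2-6)] by (rule mult_le_mono2)
  hence "k * card (U l) \<le> 2 * Q + 2 * k * Q + k * deg E x (U l)"
    using min_deg[OF assms(1)] card_U_ge[OF assms(2)] card_W by (simp add: algebra_simps)
  also have "\<dots> \<le> k * (deg E x (U l) + 4 * Q)"
    using k by (simp add: algebra_simps)
  finally show ?thesis using k by simp
qed

text \<open>
  The classes are only almost completely joined, so adjacency to a class is required up to
  $4Q$ exceptional vertices; the classes are larger than that.
\<close>

definition sees_up :: "'a \<Rightarrow> nat \<Rightarrow> bool" where
  "sees_up y j \<longleftrightarrow> (\<forall>l. j \<le> l \<longrightarrow> l < k \<longrightarrow> card (U l) \<le> card {w \<in> U l. (y, w) \<in> E} + 4 * Q)"

definition sees_down :: "'a \<Rightarrow> nat \<Rightarrow> bool" where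
  "sees_down y i \<longleftrightarrow> (\<forall>l<i. card (U l) \<le> card {w \<in> U l. (w, y) \<in> E} + 4 * Q)"

lemma sees_up_class: "u \<in> U i \<Longrightarrow> i < k \<Longrightarrow> sees_up u (Suc i)"
  unfolding sees_up_def
proof (intro allI impI)
  fix l assume *: "u \<in> U i" "i < k" "Suc i \<le> l" "l < k"
  have "u \<in> V" using * U_sub by blast
  from deg_class_ge[OF this *(2) deg_class_self[OF *(1,2)] deg_class_le[OF *(1,2)] *(4)]
  show "card (U l) \<le> card {w \<in> U l. (u, w) \<in> E} + 4 * Q"
    using * deg_class_up[of u i l] by simp
qed

lemma sees_down_class: "u \<in> U i \<Longrightarrow> i < k \<Longrightarrow> sees_down u i"
  unfolding sees_down_def
proof (intro allI impI)
  fix l assume *: "u \<in> U i" "i < k" "l < i"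
  have "u \<in> V" "l < k" using * U_sub by auto
  from deg_class_ge[OF this(1) *(2) deg_class_self[OF *(1,2)] deg_class_le[OF *(1,2)] this(2)]
  show "card (U l) \<le> card {w \<in> U l. (w, u) \<in> E} + 4 * Q"
    using * deg_class_down[of u i l] by simp
qed

section \<open>Greedy prolongation of paths through the classes\<close>

lemma exists_avoiding:
  assumes "l < k" "card (U l) \<le> card {w \<in> U l. P w} + 4 * Q" "finite F" "card F \<le> k + 3"
  shows "\<exists>u. u \<in> U l \<and> P u \<and> u \<notin> F"
proof (rule ccontr)
  assume "\<not> ?thesis"
  hence "{w \<in> U l. P w} \<subseteq> F" by blast
  hence "card {w \<in> U l. P w} \<le> card F" by (intro card_mono assms)
  thus False using card_U_large[OF assms(1)] assms by linarith
qed

text \<open>One vertex is taken from each of the classes j, ..., k-1. The chosen vertex again sees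
  all later classes, and disjointness of the classes keeps the path simple.\<close>

lemma extend_up:
  assumes "sees_up y j" "j \<le> k" "finite F" "card F \<le> k + 3"
  shows "\<exists>q. dipath E q \<and> set q \<subseteq> (\<Union>l\<in>{j..<k}. U l) - F \<and> length q = k - j \<and> (q \<noteq> [] \<longrightarrow> (y, hd q) \<in> E)"
  using assms(2,1)
proof (induction arbitrary: y rule: inc_induct)
  case base
  show ?case by (intro exI[of _ "[]"]) (auto simp: dipath_def)
next
  case (step j)
  have "card (U j) \<le> card {w \<in> U j. (y, w) \<in> E} + 4 * Q"
    using step.prems step.hyps by (auto simp: sees_up_def)
  then obtain u where u: "u \<in> U j" "(y, u) \<in> E" "u \<notin> F"
    using exists_avoiding[of j "\<lambda>w. (y, w) \<in> E" F] assms step.hyps by blast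
  obtain q where q: "dipath E q" "set q \<subseteq> (\<Union>l\<in>{Suc j..<k}. U l) - F" "length q = k - Suc j"
      "q \<noteq> [] \<longrightarrow> (u, hd q) \<in> E"
    using step.IH[OF sees_up_class[OF u(1)]] step.hyps by blast
  have "u \<notin> set q"
  proof
    assume "u \<in> set q"
    then obtain l where "l \<in> {Suc j..<k}" "u \<in> U l" using q(2) by blast
    thus False using U_eq_index[of j l u] u(1) step.hyps by auto
  qed
  hence "dipath E (u # q)" using q(1,4) by (auto simp: dipath_def successively_Cons)
  moreover have "set (u # q) \<subseteq> (\<Union>l\<in>{j..<k}. U l) - F"
  proof -
    have "{j..<k} = insert j {Suc j..<k}" using step.hyps by auto
    thus ?thesis using q(2) u by auto
  qed
  moreover have "length (u # q) = k - j" using q(3) step.hyps by simp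
  ultimately show ?case using u(2) by (intro exI[of _ "u # q"]) simp
qed

lemma extend_down:
  assumes "sees_down y i" "i \<le> k" "finite F" "card F \<le> k + 3"
  shows "\<exists>q. dipath E q \<and> set q \<subseteq> (\<Union>l<i. U l) - F \<and> length q = i \<and> (q \<noteq> [] \<longrightarrow> (last q, y) \<in> E)"
  using assms(2,1)
proof (induction i arbitrary: y)
  case 0
  show ?case by (intro exI[of _ "[]"]) (auto simp: dipath_def)
next
  case (Suc i)
  have "card (U i) \<le> card {w \<in> U i. (w, y) \<in> E} + 4 * Q"
    using Suc.prems by (auto simp: sees_down_def)
  then obtain u where u: "u \<in> U i" "(u, y) \<in> E" "u \<notin> F"
    using exists_avoiding[of i "\<lambda>w. (w, y) \<in> E" F] assms Suc.prems by auto
  obtain q where q: "dipath E q" "set q \<subseteq> (\<Union>l<i. U l) - F" "length q = i"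
      "q \<noteq> [] \<longrightarrow> (last q, u) \<in> E"
    using Suc.IH[OF _ sees_down_class[OF u(1)]] Suc.prems by auto
  have "u \<notin> set q"
  proof
    assume "u \<in> set q"
    then obtain l where "l < i" "u \<in> U l" using q(2) by blast
    thus False using U_eq_index[of i l u] u(1) Suc.prems by auto
  qed
  hence "dipath E (q @ [u])" using q(1,4) by (auto simp: dipath_def successively_append_iff)
  moreover have "set (q @ [u]) \<subseteq> (\<Union>l<Suc i. U l) - F"
    using q(2) u by (auto simp: lessThan_Suc)
  moreover have "length (q @ [u]) = Suc i" using q(3) by simp
  ultimately show ?case using u(2) by (intro exI[of _ "q @ [u]"]) simp
qed

text \<open>Prolonging m by i vertices in front and k-j behind gives a path in V, so i + |m| + (k-j)
  <= k. The front part avoids both m and the rear part, at most 3 + k vertices in all, which is the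
  origin of the bound k+3.\<close>

lemma bridge:
  assumes m: "dipath E m" "set m \<subseteq> V" "m \<noteq> []" "length m \<le> 3"
    and ij: "i \<le> k" "j \<le> k" "sees_down (hd m) i" "sees_up (last m) j"
  shows "length m + i \<le> j"
proof -
  have cm: "card (set m) \<le> 3" using m(4) card_length[of m] by linarith
  obtain q where q: "dipath E q" "set q \<subseteq> (\<Union>l\<in>{j..<k}. U l) - set m" "length q = k - j"
      "q \<noteq> [] \<longrightarrow> (last m, hd q) \<in> E"
    using extend_up[OF ij(4,2), of "set m"] cm by auto
  have "card (set m \<union> set q) \<le> k + 3"
    using card_Un_le[of "set m" "set q"] cm card_length[of q] q(3) by linarith
  then obtain r where r: "dipath E r" "set r \<subseteq> (\<Union>l<i. U l) - (set m \<union> set q)" "length r = i"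
      "r \<noteq> [] \<longrightarrow> (last r, hd m) \<in> E"
    using extend_down[OF ij(3,1), of "set m \<union> set q"] by auto
  have "dipath E (r @ m @ q)"
    using m q r by (auto simp: dipath_def successively_append_iff)
  moreover have "set (r @ m @ q) \<subseteq> V"
  proof -
    have "set r \<subseteq> (\<Union>l<i. U l)" "set q \<subseteq> (\<Union>l\<in>{j..<k}. U l)" using q(2) r(2) by blast+
    moreover have "(\<Union>l<i. U l) \<subseteq> V" "(\<Union>l\<in>{j..<k}. U l) \<subseteq> V"
      using ij(1) unfolding V_eq by force+
    ultimately show ?thesis using m(2) by auto
  qed
  ultimately have "length (r @ m @ q) \<le> k" using pb unfolding path_bounded_def by blast
  thus ?thesis using q(3) r(3) ij(2) by simp
qed

section \<open>Locating an arbitrary vertex, exceptional or not, between the classes\<close>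

lemma in_out:
  assumes "x \<in> V" "i < k" "j < k" "u \<in> U i" "(u, x) \<in> E" "w \<in> U j" "(x, w) \<in> E" "u \<noteq> w"
  shows "i + 2 \<le> j"
proof -
  have "dipath E [u, x, w]" using assms irr by (auto simp: dipath_def irrefl_def)
  moreover have "set [u, x, w] \<subseteq> V" using assms U_sub by auto
  ultimately have "length [u, x, w] + i \<le> Suc j"
    by (rule bridge) (use assms sees_down_class sees_up_class in auto)
  thus ?thesis by simp
qed

lemma out_pos:
  assumes "x \<in> V" "j < k" "w \<in> U j" "(x, w) \<in> E"
  shows "1 \<le> j"
proof -
  have "dipath E [x, w]" using assms irr by (auto simp: dipath_def irrefl_def)
  moreover have "set [x, w] \<subseteq> V" using assms U_sub by auto
  \<comment> \<open>\<open>sees_down x 0\<close> is vacuous, so nothing has to precede x; likewise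
    \<open>sees_up x k\<close> is vacuous when x ends the path.\<close>
  ultimately have "length [x, w] + 0 \<le> Suc j"
    by (rule bridge) (use assms sees_up_class in \<open>auto simp: sees_down_def\<close>)
  thus ?thesis by simp
qed

lemma in_lt:
  assumes "x \<in> V" "i < k" "u \<in> U i" "(u, x) \<in> E"
  shows "i + 2 \<le> k"
proof -
  have "dipath E [u, x]" using assms irr by (auto simp: dipath_def irrefl_def)
  moreover have "set [u, x] \<subseteq> V" using assms U_sub by auto
  ultimately have "length [u, x] + i \<le> k"
    by (rule bridge) (use assms sees_down_class in \<open>auto simp: sees_up_def\<close>)
  thus ?thesis by simp
qed

text \<open>An in-neighbour and a distinct out-neighbour of x in the same class would contradict
  \<open>in_out\<close>. So either one kind is absent, or both kinds consist of one common vertex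
  and the degree is at most 2.\<close>

lemma deg_U_le:
  assumes x: "x \<in> V" and l: "l < k"
  shows "deg E x (U l) \<le> card (U l)"
proof -
  let ?I = "{w \<in> U l. (w, x) \<in> E}" and ?O = "{w \<in> U l. (x, w) \<in> E}"
  have eq: "u = w" if "u \<in> ?I" "w \<in> ?O" for u w
    using in_out[OF x l l, of u w] that by auto
  consider "?I = {}" | "?O = {}" | u w where "u \<in> ?I" "w \<in> ?O" by blast
  thus ?thesis
  proof cases
    case 1
    thus ?thesis unfolding deg_def 1 using fin_U[OF l] by (auto intro: card_mono)
  next
    case 2
    thus ?thesis unfolding deg_def 2 using fin_U[OF l] by (auto intro: card_mono)
  next
    case 3
    hence "?I \<subseteq> {w}" "?O \<subseteq> {w}" using eq by blast+
    hence "card ?I \<le> 1" "card ?O \<le> 1" by (metis card_mono finite.emptyI finite_insert is_singletonI is_singleton_altdef)+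
    thus ?thesis using card_U_large[OF l] by (simp add: deg_def)
  qed
qed

text \<open>What remains is u = w, an opposite pair between x and class i. By \<open>in_out\<close>,
  x then has no other neighbour in class i and none at all in class i+1. Two classes are thus almost
  entirely missed, which \<open>min_deg\<close> forbids.\<close>

lemma in_out_strict:
  assumes x: "x \<in> V" and ij: "i < k" "j < k" and u: "u \<in> U i" "(u, x) \<in> E" and w: "w \<in> U j" "(x, w) \<in> E"
  shows "i + 2 \<le> j"
proof (rule ccontr)
  assume n: "\<not> ?thesis"
  hence uw: "u = w" using in_out[OF x ij u w] by blast
  hence ji: "j = i" using U_eq_index[of i j u] ij u w by simp
  have Si: "Suc i < k" using in_lt[OF x ij(1) u] by simp
  have ne: "w' \<noteq> u" if "w' \<in> U (Suc i)" for w'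
    using U_eq_index[of i "Suc i" u] u(1) Si that by auto
  have "{w' \<in> U (Suc i). (w', x) \<in> E} = {}"
    using in_out[OF x Si ij(2) _ _ w] ne uw ji by force
  moreover have "{w' \<in> U (Suc i). (x, w') \<in> E} = {}"
    using in_out[OF x ij(1) Si u] ne by force
  ultimately have d0: "deg E x (U (Suc i)) = 0" by (simp only: deg_def card.empty)
  have "{w' \<in> U i. (w', x) \<in> E} \<subseteq> {w}"
    using in_out[OF x ij(1) ij(2) _ _ w] ji by force
  moreover have "{w' \<in> U i. (x, w') \<in> E} \<subseteq> {w}"
    using in_out[OF x ij(1) ij(1) u] uw by force
  ultimately have "card {w' \<in> U i. (w', x) \<in> E} \<le> card {w}" "card {w' \<in> U i. (x, w') \<in> E} \<le> card {w}"
    by (simp_all only: card_mono finite.intros)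
  hence d2: "deg E x (U i) \<le> 2" by (simp add: deg_def)
  have "deg E x V + card (U (Suc i)) + card (U i) \<le> 2 * card W + card V + deg E x (U i)"
    using deg_missing(2)[OF Si d0 deg_U_le[OF x] ij(1)] by simp
  hence "k * (deg E x V + card (U (Suc i)) + card (U i)) \<le> k * (2 * card W + card V + 2)"
    using d2 by (intro mult_le_mono2) linarith
  hence "k * deg E x V + k * card (U (Suc i)) + k * card (U i) \<le> Q + k * card V + 2 * k"
    using card_W by (simp add: algebra_simps)
  hence "card V \<le> 2 * Q + 4 * (k * Q) + 2 * k"
    using min_deg[OF x] card_U_ge[OF Si] card_U_ge[OF ij(1)] by simp
  moreover have "Q \<le> k * Q" using k by simp
  moreover have "k * (6 * Q + k + 4) = 6 * (k * Q) + k * k + 4 * k" by (simp add: algebra_simps)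
  ultimately show False using large by linarith
qed

text \<open>Take m just above the last class sending an arc to x, or 0 if there is none. By
  \<open>in_out_strict\<close> and \<open>out_pos\<close> all out-neighbours in the classes lie
  beyond m, so x misses class m, and \<open>deg_class_ge\<close> makes x nearly complete to all
  others.\<close>

lemma exists_type:
  assumes x: "x \<in> V"
  shows "\<exists>m<k. sees_down x m \<and> sees_up x (Suc m)"
proof -
  define I where "I = {i. i < k \<and> (\<exists>u\<in>U i. (u, x) \<in> E)}"
  have fI: "finite I" by (auto simp: I_def)
  define m where "m = (if I = {} then 0 else Suc (Max I))"
  have MI: "Max I \<in> I" if "I \<noteq> {}" using Max_in[OF fI that] .
  have mk: "m < k"
  proof (cases "I = {}")
    case True
    thus ?thesis using k by (simp add: m_def)
  next
    case False
    then obtain u where "u \<in> U (Max I)" "(u, x) \<in> E" "Max I < k" using MI by (auto simp: I_def)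
    thus ?thesis using in_lt[OF x] False by (force simp: m_def)
  qed
  have inn: "l < m" if "l < k" "u \<in> U l" "(u, x) \<in> E" for l u
  proof -
    have "l \<in> I" using that by (auto simp: I_def)
    thus ?thesis using Max_ge[OF fI] by (auto simp: m_def less_Suc_eq_le)
  qed
  have out: "m < l" if "l < k" "w \<in> U l" "(x, w) \<in> E" for l w
  proof (cases "I = {}")
    case True
    thus ?thesis using out_pos[OF x that] by (simp add: m_def)
  next
    case False
    then obtain u where "u \<in> U (Max I)" "(u, x) \<in> E" "Max I < k" using MI by (auto simp: I_def)
    thus ?thesis using in_out_strict[OF x _ that(1) _ _ that(2,3)] False by (force simp: m_def)
  qed
  have I0: "{w \<in> U l. (w, x) \<in> E} = {}" if "l < k" "m \<le> l" for l
    using inn[OF that(1)] that(2) by force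
  have O0: "{w \<in> U l. (x, w) \<in> E} = {}" if "l < k" "l \<le> m" for l
    using out[OF that(1)] that(2) by force
  have d0: "deg E x (U m) = 0" using I0[OF mk] O0[OF mk] by (simp only: deg_def card.empty order_refl)
  have ge: "card (U l) \<le> deg E x (U l) + 4 * Q" if "l < k" "l \<noteq> m" for l
    by (rule deg_class_ge[OF x mk d0 deg_U_le[OF x] that])
  have "sees_down x m"
    unfolding sees_down_def
  proof (intro allI impI)
    fix l assume l: "l < m"
    hence "deg E x (U l) = card {w \<in> U l. (w, x) \<in> E}" using O0[of l] mk by (simp only: deg_def) simp
    thus "card (U l) \<le> card {w \<in> U l. (w, x) \<in> E} + 4 * Q" using ge[of l] l mk by simp
  qed
  moreover have "sees_up x (Suc m)"
    unfolding sees_up_def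
  proof (intro allI impI)
    fix l assume l: "Suc m \<le> l" "l < k"
    hence "deg E x (U l) = card {w \<in> U l. (x, w) \<in> E}" using I0[of l] mk by (simp only: deg_def) simp
    thus "card (U l) \<le> card {w \<in> U l. (x, w) \<in> E} + 4 * Q" using ge[of l] l by simp
  qed
  ultimately show ?thesis using mk by blast
qed

theorem exists_coloring:
  "\<exists>c. (\<forall>x\<in>V. c x < k) \<and> (\<forall>x\<in>V. \<forall>y\<in>V. (x, y) \<in> E \<longrightarrow> c x < c y)"
proof -
  from exists_type have "\<forall>x\<in>V. \<exists>m. m < k \<and> sees_down x m \<and> sees_up x (Suc m)" by blast
  then obtain c where c: "\<And>x. x \<in> V \<Longrightarrow> c x < k \<and> sees_down x (c x) \<and> sees_up x (Suc (c x))"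
    by metis
  have "c x < c y" if xy: "x \<in> V" "y \<in> V" "(x, y) \<in> E" for x y
  proof -
    have "dipath E [x, y]" using xy irr by (auto simp: dipath_def irrefl_def)
    moreover have "set [x, y] \<subseteq> V" using xy by auto
    \<comment> \<open>Bridging the arc itself gives 2 + c x <= c y + 1.\<close>
    ultimately have "length [x, y] + c x \<le> Suc (c y)"
      by (rule bridge) (use c[of x] c[of y] xy in auto)
    thus ?thesis by simp
  qed
  with c show ?thesis by blast
qed

end

section \<open>From near-extremal density to a colouring by which all arcs increase\<close>

definition class_const :: "nat \<Rightarrow> nat" where
  "class_const k = 2 * k * ((8 * k ^ 3 + 2)\<^sup>2 + 2 * k + 16 * k ^ 4 + 1)"

text \<open>\<open>class_const\<close> plays the role of \<open>Q\<close>: its bracket exceeds the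
  bound on |W| by 1, and this also covers the degree error. The threshold provides
  \<open>large\<close> and the 8k^3 + 2 vertices demanded by
  \<open>exists_tournament_path\<close>.\<close>

definition threshold :: "nat \<Rightarrow> nat" where
  "threshold k = k * (6 * class_const k + k + 4) + 8 * k ^ 3 + 3"

text \<open>Every deficient vertex removes at least one arc from the exact balance behind
  \<open>path_bounded_arcs_le\<close>. The slack there is the additive constant, and
  near-extremality adds k.\<close>

lemma deficient_vertices:
  assumes k: "k \<ge> 1" and V: "finite V" and E: "irrefl E" "path_bounded E k V"
    and e: "real (arcs_in E V) \<ge> (real k - 1) / (2 * real k) * (real (card V))\<^sup>2 - real k"
    and p: "dipath E p" "set p \<subseteq> V" "length p = k" "2 * arcs_in E (set p) \<le> k * (k - 1)"
  shows "card {v \<in> V - set p. deg E v (set p) \<noteq> k - 1} \<le> (8 * k ^ 3 + 2)\<^sup>2 + k"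
proof -
  let ?S = "set p" and ?n = "real (card V)"
  define X where "X = {v \<in> V - ?S. deg E v ?S \<noteq> k - 1}"
  have fX: "finite (V - ?S)" "X \<subseteq> V - ?S" using V by (auto simp: X_def)
  have cS: "card ?S = k" using p(1,3) distinct_card by (auto simp: dipath_def)
  have kn: "k \<le> card V" using cS p(2) V card_mono by metis
  have c: "card (V - ?S) = card V - k" using p(2) cS by (simp add: card_Diff_subset)
  \<comment> \<open>The indicator records a shortfall of at least one at each vertex of
    \<open>X\<close>.\<close>
  have "(\<Sum>v\<in>V - ?S. deg E v ?S + of_bool (v \<in> X)) \<le> (\<Sum>v\<in>V - ?S. k - 1)"
  proof (rule sum_mono)
    fix v assume v: "v \<in> V - ?S"
    hence "deg E v ?S \<le> k - 1" using attach_deg(1)[OF E(2) p(1-3), of v] k by simp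
    thus "deg E v ?S + of_bool (v \<in> X) \<le> k - 1" by (auto simp: X_def)
  qed
  moreover have "(\<Sum>v\<in>V - ?S. of_bool (v \<in> X)) = card X"
  proof -
    have "(V - ?S) \<inter> X = X" using fX(2) by blast
    thus ?thesis using fX(1) by (simp add: of_bool_def sum.If_cases)
  qed
  ultimately have "(\<Sum>v\<in>V - ?S. deg E v ?S) + card X \<le> (card V - k) * (k - 1)"
    using c by (simp add: sum.distrib)
  hence "arcs_in E V + card X \<le> arcs_in E (V - ?S) + arcs_in E ?S + (card V - k) * (k - 1)"
    using arcs_in_split[OF V p(2), of E] by simp
  hence "real (arcs_in E V + card X) \<le> real (arcs_in E (V - ?S) + arcs_in E ?S + (card V - k) * (k - 1))"
    by (simp only: of_nat_le_iff)
  also have "\<dots> = real (arcs_in E (V - ?S)) + real (arcs_in E ?S) + (?n - real k) * (real k - 1)"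
    using kn k by (simp add: of_nat_diff)
  finally have 1: "real (arcs_in E V) + real (card X)
      \<le> real (arcs_in E (V - ?S)) + real (arcs_in E ?S) + (?n - real k) * (real k - 1)" by simp
  have "real (2 * arcs_in E ?S) \<le> real (k * (k - 1))" using p(4) by (simp only: of_nat_le_iff)
  hence 2: "real (arcs_in E ?S) \<le> real k * (real k - 1) / 2" using k by (simp add: of_nat_diff)
  have 3: "(real k - 1) / (2 * real k) * (?n - real k)\<^sup>2 + real k * (real k - 1) / 2 + (?n - real k) * (real k - 1)
      = (real k - 1) / (2 * real k) * ?n\<^sup>2"
    using k by (simp add: field_simps power2_eq_square)
  have "real (arcs_in E (V - ?S)) \<le> (real k - 1) / (2 * real k) * (?n - real k)\<^sup>2 + (8 * real k ^ 3 + 2)\<^sup>2"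
    using path_bounded_arcs_le[OF k fX(1) E(1) path_bounded_mono[OF E(2)]] c kn by (simp add: of_nat_diff)
  with 1 2 3 e have "real (card X) \<le> (8 * real k ^ 3 + 2)\<^sup>2 + real k" by linarith
  also have "\<dots> = real ((8 * k ^ 3 + 2)\<^sup>2 + k)" by simp
  finally show ?thesis unfolding X_def by (simp only: of_nat_le_iff)
qed

text \<open>The exceptional set $W$ consists of the path, the vertices joined to it by fewer than $k-1$ arcs,
  and those lying on a pair of opposite arcs with it. Every other vertex can replace exactly one
  vertex of the path, which determines its class.\<close>

lemma dense_imp_coloring:
  fixes E :: "('a \<times> 'a) set"
  assumes k: "k \<ge> 1" and V: "finite V" and E: "irrefl E" "path_bounded E k V"
    and n: "threshold k \<le> card V"
    and e: "real (arcs_in E V) \<ge> (real k - 1) / (2 * real k) * (real (card V))\<^sup>2 - real k"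
  shows "\<exists>c. (\<forall>x\<in>V. c x < k) \<and> (\<forall>x\<in>V. \<forall>y\<in>V. (x, y) \<in> E \<longrightarrow> c x < c y)"
proof -
  have "8 * k ^ 3 + 2 \<le> card V" using n by (simp add: threshold_def)
  from exists_tournament_path[OF k V E this e]
  obtain p where p: "dipath E p" "set p \<subseteq> V" "length p = k" "2 * arcs_in E (set p) \<le> k * (k - 1)"
    and T: "\<And>x. x \<in> set p \<Longrightarrow> card {u \<in> V. (u, x) \<in> E \<and> (x, u) \<in> E} \<le> 16 * k ^ 3" by blast
  define X where "X = {v \<in> V - set p. deg E v (set p) \<noteq> k - 1}"
  define Y where "Y = (\<Union>x\<in>set p. {u \<in> V. (u, x) \<in> E \<and> (x, u) \<in> E})"
  define W where "W = set p \<union> X \<union> Y"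
  define fits where "fits m v \<longleftrightarrow> (\<forall>i<k. ((p ! i, v) \<in> E \<longleftrightarrow> i < m) \<and> ((v, p ! i) \<in> E \<longleftrightarrow> m < i))" for m v
  define U where "U m = {v \<in> V - W. fits m v}" for m
  have cX: "card X \<le> (8 * k ^ 3 + 2)\<^sup>2 + k"
    unfolding X_def by (rule deficient_vertices[OF k V E e p])
  have "card Y \<le> (\<Sum>x\<in>set p. card {u \<in> V. (u, x) \<in> E \<and> (x, u) \<in> E})"
    unfolding Y_def by (rule card_UN_le) simp
  also have "\<dots> \<le> (\<Sum>x\<in>set p. 16 * k ^ 3)" by (intro sum_mono T)
  also have "\<dots> = card (set p) * (16 * k ^ 3)" by simp
  also have "\<dots> \<le> k * (16 * k ^ 3)" using card_length[of p] p(3) by (intro mult_le_mono1) simp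
  finally have cY: "card Y \<le> 16 * k ^ 4" by (simp add: numeral_eq_Suc algebra_simps)
  have "card W \<le> card (set p) + card X + card Y"
    unfolding W_def by (intro order_trans[OF card_Un_le] add_mono card_Un_le order_refl)
  hence cW: "card W \<le> (8 * k ^ 3 + 2)\<^sup>2 + 2 * k + 16 * k ^ 4"
    using cX cY card_length[of p] p(3) by linarith
  have "class_system E V W k (class_const k) U"
  proof
    show "k \<ge> 1" "finite V" "irrefl E" "path_bounded E k V" by fact+
    have ex: "\<exists>m<k. fits m v" if v: "v \<in> V - W" for v
    proof -
      have "v \<in> V" "v \<notin> set p" "deg E v (set p) = k - 1"
           "\<And>x. x \<in> set p \<Longrightarrow> (x, v) \<in> E \<Longrightarrow> (v, x) \<notin> E"
        using v by (auto simp: W_def X_def Y_def)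
      thus ?thesis unfolding fits_def using attach_type[OF E(2) p(1-3) _ _ k] by blast
    qed
    have "W \<subseteq> V" using p(2) by (auto simp: W_def X_def Y_def)
    thus "V = W \<union> (\<Union>i<k. U i)" using ex by (auto simp: U_def)
    show "W \<inter> U i = {}" for i by (auto simp: U_def)
    have uniq: False if "fits a v" "fits b v" "a < b" "b < k" for a b v
    proof -
      have "a < k" using that by simp
      \<comment> \<open>The path vertex with the smaller index separates the types: it sends an arc
        to v under type b but not under type a.\<close>
      hence "((p ! a, v) \<in> E) = (a < a)" "((p ! a, v) \<in> E) = (a < b)"
        using that(1,2) unfolding fits_def by blast+
      thus False using that(3) by simp
    qed
    show "disjoint_family_on U {..<k}"
      unfolding disjoint_family_on_def
    proof (intro ballI impI)
      fix a b assume "a \<in> {..<k}" "b \<in> {..<k}" "a \<noteq> b"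
      thus "U a \<inter> U b = {}"
        using uniq[of a _ b] uniq[of b _ a] by (auto simp: U_def) (metis linorder_neqE_nat)
    qed
    show "i < j" if "i < k" "j < k" "u \<in> U i" "w \<in> U j" "(u, w) \<in> E" for i j u w
    proof (rule ccontr)
      assume "\<not> i < j"
      hence ji: "j \<le> i" by simp
      have uw: "u \<noteq> w" using that(5) E(1) by (auto simp: irrefl_def)
      have nin: "u \<notin> set p" "w \<notin> set p" using that by (auto simp: U_def W_def)
      \<comment> \<open>Replace the single vertex p_i by the arc from u to w. The vertex u accepts
        an arc from p_{i-1} since its type is i, and w sends one to p_{i+1} since j < i+1; the
        result has k+1 vertices.\<close>
      let ?q = "take i p @ [u, w] @ drop (Suc i) p"
      have "distinct ?q"
        using p(1) uw nin set_take_disj_set_drop_if_distinct[of p i "Suc i"]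
        by (auto simp: dipath_def dest: in_set_takeD in_set_dropD)
      moreover have "successively (\<lambda>x y. (x, y) \<in> E) (take i p)" "successively (\<lambda>x y. (x, y) \<in> E) (drop (Suc i) p)"
        using p(1) by (metis append_take_drop_id dipath_def successively_append_iff)+
      moreover have "(last (take i p), u) \<in> E" if "take i p \<noteq> []"
      proof -
        have "last (take i p) = p ! (i - 1)" using that p(3) \<open>i < k\<close> by (subst last_conv_nth) auto
        thus ?thesis using that \<open>u \<in> U i\<close> \<open>i < k\<close> by (auto simp: U_def fits_def)
      qed
      moreover have "(w, hd (drop (Suc i) p)) \<in> E" if "drop (Suc i) p \<noteq> []"
      proof -
        have *: "Suc i < k" using that p(3) by simp
        hence "hd (drop (Suc i) p) = p ! Suc i" using p(3) by (simp add: hd_drop_conv_nth)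
        moreover have "j < Suc i" using ji by simp
        ultimately show ?thesis using * \<open>w \<in> U j\<close> by (auto simp: U_def fits_def)
      qed
      ultimately have "dipath E ?q" using that(5)
        by (auto simp: dipath_def successively_append_iff successively_Cons)
      moreover have "set ?q \<subseteq> V"
        using p(2) that(3,4) by (auto simp: U_def dest: in_set_takeD in_set_dropD)
      ultimately have "length ?q \<le> k" using E(2) unfolding path_bounded_def by blast
      thus False using p(3) that(1) by simp
    qed
    show "k * card V \<le> k * deg E x V + card V + class_const k" if "x \<in> V" for x
    proof -
      have "(real k - 1) / real k * real (card V) - ((8 * real k ^ 3 + 2)\<^sup>2 + real k + 1) \<le> real (deg E x V)"
        by (rule path_bounded_min_deg[OF k V E e that])
      hence "real k * ((real k - 1) / real k * real (card V) - ((8 * real k ^ 3 + 2)\<^sup>2 + real k + 1)) \<le> real k * real (deg E x V)"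
        by (rule mult_left_mono) simp
      moreover have "real k * ((real k - 1) / real k * real (card V) - ((8 * real k ^ 3 + 2)\<^sup>2 + real k + 1))
         = real k * real (card V) - real (card V) - real k * ((8 * real k ^ 3 + 2)\<^sup>2 + real k + 1)"
        using k by (simp add: field_simps)
      ultimately have "real k * real (card V) \<le> real k * real (deg E x V) + real (card V) + real k * ((8 * real k ^ 3 + 2)\<^sup>2 + real k + 1)"
        by linarith
      also have "\<dots> = real (k * deg E x V + card V + k * ((8 * k ^ 3 + 2)\<^sup>2 + k + 1))" by (simp add: algebra_simps)
      finally have "k * card V \<le> k * deg E x V + card V + k * ((8 * k ^ 3 + 2)\<^sup>2 + k + 1)"
        by (simp only: of_nat_le_iff flip: of_nat_mult)
      also have "k * ((8 * k ^ 3 + 2)\<^sup>2 + k + 1) \<le> class_const k"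
        unfolding class_const_def by (intro mult_le_mono) auto
      finally show ?thesis by simp
    qed
    show "2 * k * card W \<le> class_const k"
      unfolding class_const_def by (intro mult_le_mono2) (use cW in linarith)
    show "k * (6 * class_const k + k + 4) < card V" using n by (simp add: threshold_def)
  qed
  thus ?thesis by (rule class_system.exists_coloring)
qed

section \<open>Counting forward pairs\<close>

definition forward_pairs :: "'a set \<Rightarrow> ('a \<Rightarrow> nat) \<Rightarrow> ('a \<times> 'a) set" where
  "forward_pairs V c = {(x, y). x \<in> V \<and> y \<in> V \<and> c x < c y}"

definition class_size :: "'a set \<Rightarrow> ('a \<Rightarrow> nat) \<Rightarrow> nat \<Rightarrow> nat" where
  "class_size V c i = card {x \<in> V. c x = i}"

lemma finite_forward_pairs: "finite V \<Longrightarrow> finite (forward_pairs V c)"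
  by (rule finite_subset[of _ "V \<times> V"]) (auto simp: forward_pairs_def)

lemma sum_class_size:
  assumes "finite V" "\<And>x. x \<in> V \<Longrightarrow> c x < k"
  shows "(\<Sum>i<k. class_size V c i) = card V"
proof -
  have "V = (\<Union>i<k. {x \<in> V. c x = i})" using assms(2) by auto
  hence "card V = card (\<Union>i<k. {x \<in> V. c x = i})" by simp
  also have "\<dots> = (\<Sum>i<k. card {x \<in> V. c x = i})"
    by (rule card_UN_disjoint) (use assms in auto)
  finally show ?thesis by (simp add: class_size_def)
qed

text \<open>V x V splits into forward pairs, their converses, and the squares of the colour
  classes.\<close>

lemma card_forward_pairs_squares:
  assumes "finite V" "\<And>x. x \<in> V \<Longrightarrow> c x < k"
  shows "2 * card (forward_pairs V c) + (\<Sum>i<k. class_size V c i * class_size V c i) = card V * card V"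
proof -
  let ?F = "forward_pairs V c" and ?S = "\<Union>i<k. {x \<in> V. c x = i} \<times> {x \<in> V. c x = i}"
  have fF: "finite ?F" by (rule finite_forward_pairs[OF assms(1)])
  have eq: "V \<times> V = (?F \<union> ?F\<inverse>) \<union> ?S" using assms(2) by (auto simp: forward_pairs_def)
  have "card ?S = (\<Sum>i<k. card ({x \<in> V. c x = i} \<times> {x \<in> V. c x = i}))"
    by (rule card_UN_disjoint) (use assms in auto)
  hence cS: "card ?S = (\<Sum>i<k. class_size V c i * class_size V c i)"
    by (simp add: class_size_def card_cartesian_product)
  have "card (V \<times> V) = card (?F \<union> ?F\<inverse>) + card ?S"
    unfolding eq by (rule card_Un_disjoint) (use assms fF in \<open>auto simp: forward_pairs_def\<close>)
  also have "card (?F \<union> ?F\<inverse>) = card ?F + card (?F\<inverse>)"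
    by (rule card_Un_disjoint) (use fF in \<open>auto simp: forward_pairs_def\<close>)
  finally show ?thesis by (simp add: cS card_cartesian_product)
qed

text \<open>Twice the arc number of a Turan digraph with $n = qk + r$. In this form the excess of
  $\sum_i s_i^2$ over its minimum is $\sum_i (s_i - q)(s_i - q - 1)$, which vanishes iff all
  $s_i \in \{q, q+1\}$.\<close>

definition turan_twice :: "nat \<Rightarrow> nat \<Rightarrow> nat \<Rightarrow> int" where
  "turan_twice k q n = (int n)\<^sup>2 - (2 * int q + 1) * int n + int k * int q * (int q + 1)"

lemma card_forward_pairs:
  assumes "finite V" "\<And>x. x \<in> V \<Longrightarrow> c x < k"
  shows "2 * int (card (forward_pairs V c)) = turan_twice k q (card V)
    - (\<Sum>i<k. (int (class_size V c i) - int q) * (int (class_size V c i) - int q - 1))"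
proof -
  let ?s = "\<lambda>i. int (class_size V c i)"
  have s: "(\<Sum>i<k. ?s i) = int (card V)"
    using arg_cong[OF sum_class_size[OF assms], where f = int] by simp
  have "int (2 * card (forward_pairs V c) + (\<Sum>i<k. class_size V c i * class_size V c i)) = int (card V * card V)"
    using card_forward_pairs_squares[OF assms] by (simp only:)
  hence ss: "2 * int (card (forward_pairs V c)) + (\<Sum>i<k. ?s i * ?s i) = int (card V) * int (card V)" by simp
  have "(\<Sum>i<k. (?s i - int q) * (?s i - int q - 1))
      = (\<Sum>i<k. ?s i * ?s i - (2 * int q + 1) * ?s i + int q * (int q + 1))"
    by (intro sum.cong refl) (simp add: algebra_simps)
  also have "\<dots> = (\<Sum>i<k. ?s i * ?s i) - (2 * int q + 1) * (\<Sum>i<k. ?s i) + int k * (int q * (int q + 1))"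
    by (simp add: sum.distrib sum_subtractf sum_distrib_left)
  finally show ?thesis using ss s by (simp add: turan_twice_def power2_eq_square algebra_simps)
qed

lemma consecutive_product_nonneg: "(z::int) * (z - 1) \<ge> 0"
  by (cases "z \<ge> 1") (auto simp: zero_le_mult_iff)

lemma turan_twice_real:
  assumes "k \<ge> 1" "n = q * k + r"
  shows "real_of_int (turan_twice k q n) / 2
    = (real k - 1) / (2 * real k) * (real n)\<^sup>2 - real r * (real k - real r) / (2 * real k)"
proof -
  have n: "real n = real q * real k + real r" using assms(2) by simp
  have T: "real_of_int (turan_twice k q n) = (real n)\<^sup>2 - (2 * real q + 1) * real n + real k * real q * (real q + 1)"
    by (simp add: turan_twice_def)
  have "real_of_int (turan_twice k q n) * real k = (real k - 1) * (real n)\<^sup>2 - real r * (real k - real r)"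
    unfolding T n by (simp add: algebra_simps power2_eq_square)
  hence T': "real_of_int (turan_twice k q n) = ((real k - 1) * (real n)\<^sup>2 - real r * (real k - real r)) / real k"
    using assms(1) by (simp add: eq_divide_eq)
  show ?thesis unfolding T' using assms(1) by (simp add: field_simps)
qed

text \<open>With the colouring at hand, 2|E| is at most twice the number of forward pairs, hence at
  most \<open>turan_twice\<close>, which is at most 2|E| by assumption. Equality throughout fixes
  the arcs and annihilates every nonnegative term of the excess.\<close>

lemma extremal_structure:
  fixes E :: "('a \<times> 'a) set"
  assumes k: "k \<ge> 1" and V: "finite V" and E: "E \<subseteq> V \<times> V" "irrefl E" "path_bounded E k V"
    and n: "threshold k \<le> card V" "card V = q * k + r" "r < k"
    and e: "turan_twice k q (card V) \<le> 2 * int (card E)"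
  shows "2 * int (card E) = turan_twice k q (card V)"
    and "\<exists>c. (\<forall>x\<in>V. c x < k) \<and> E = forward_pairs V c \<and>
      (\<forall>i<k. class_size V c i = q \<or> class_size V c i = Suc q)"
proof -
  have aE: "arcs_in E V = card E" using E(1) by (simp add: arcs_in_def Int_absorb2)
  \<comment> \<open>The Turan number falls short of (k-1)n^2/(2k) by r(k-r)/(2k) <= k, which
    explains the slack k in the density hypotheses.\<close>
  have "real r * (real k - real r) \<le> real k * (2 * real k)" using n(3) by (intro mult_mono) auto
  hence "real r * (real k - real r) / (2 * real k) \<le> real k"
    using k by (subst pos_divide_le_eq) auto
  moreover have "real_of_int (turan_twice k q (card V)) \<le> 2 * real (card E)"
    using e by (metis of_int_le_iff of_int_mult of_int_numeral of_int_of_nat_eq)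
  ultimately have "real (arcs_in E V) \<ge> (real k - 1) / (2 * real k) * (real (card V))\<^sup>2 - real k"
    using turan_twice_real[OF k n(2)] unfolding aE by linarith
  from dense_imp_coloring[OF k V E(2,3) n(1) this]
  obtain c where c: "\<And>x. x \<in> V \<Longrightarrow> c x < k" "\<And>x y. x \<in> V \<Longrightarrow> y \<in> V \<Longrightarrow> (x, y) \<in> E \<Longrightarrow> c x < c y"
    by blast
  let ?z = "\<lambda>i. int (class_size V c i) - int q"
  have sub: "E \<subseteq> forward_pairs V c" using c(2) E(1) by (auto simp: forward_pairs_def)
  have le: "card E \<le> card (forward_pairs V c)"
    by (rule card_mono[OF finite_forward_pairs[OF V] sub])
  have F: "2 * int (card (forward_pairs V c)) = turan_twice k q (card V) - (\<Sum>i<k. ?z i * (?z i - 1))"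
    by (rule card_forward_pairs[OF V c(1)])
  have pos: "(\<Sum>i<k. ?z i * (?z i - 1)) \<ge> 0"
    by (intro sum_nonneg consecutive_product_nonneg)
  show "2 * int (card E) = turan_twice k q (card V)" using le F pos e by linarith
  have "E = forward_pairs V c"
    by (rule card_subset_eq[OF finite_forward_pairs[OF V] sub]) (use le F pos e in linarith)
  moreover have S0: "(\<Sum>i<k. ?z i * (?z i - 1)) = 0" using le F pos e by linarith
  have z: "\<forall>i\<in>{..<k}. ?z i * (?z i - 1) = 0"
    using S0 by (rule iffD1[OF sum_nonneg_eq_0_iff, rotated 2]) (use consecutive_product_nonneg in blast)+
  have "class_size V c i = q \<or> class_size V c i = Suc q" if "i < k" for i
  proof -
    have "?z i * (?z i - 1) = 0" using z that by simp
    hence "?z i = 0 \<or> ?z i = 1" by simp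
    thus ?thesis by linarith
  qed
  ultimately show "\<exists>c. (\<forall>x\<in>V. c x < k) \<and> E = forward_pairs V c \<and>
      (\<forall>i<k. class_size V c i = q \<or> class_size V c i = Suc q)" using c(1) by blast
qed

section \<open>Balanced colourings and the extremal example\<close>

lemma balanced_sizes:
  fixes s :: "nat \<Rightarrow> nat"
  assumes "(\<Sum>i<k. s i) = q * k + r" "r < k" "\<And>i j. i < k \<Longrightarrow> j < k \<Longrightarrow> s i \<le> s j + 1" "i < k"
  shows "s i = q \<or> s i = Suc q"
proof -
  \<comment> \<open>A class smaller than q would cap all classes at q, making the total less than
    qk. Dually, one above q+1 would raise the total to at least (q+1)k, contradicting r < k.\<close>
  have lo: "q \<le> s i"  if i: "i < k" for i
  proof (rule ccontr)
    assume "\<not> q \<le> s i"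
    hence "s j \<le> q" if "j < k" for j using assms(3)[OF that i] by simp
    moreover have "s i < q" using \<open>\<not> q \<le> s i\<close> by simp
    ultimately have "(\<Sum>i<k. s i) < (\<Sum>i<k. q)" by (intro sum_strict_mono_ex1) (use i in auto)
    thus False using assms(1) by (simp add: mult.commute)
  qed
  have "s i \<le> Suc q"
  proof (rule ccontr)
    assume "\<not> s i \<le> Suc q"
    hence "Suc q \<le> s j" if "j < k" for j using assms(3)[OF assms(4) that] by simp
    hence "(\<Sum>i<k. Suc q) \<le> (\<Sum>i<k. s i)" by (intro sum_mono) auto
    thus False using assms(1,2) by (simp add: algebra_simps)
  qed
  with lo[OF assms(4)] show ?thesis by auto
qed

lemma card_forward_pairs_balanced:
  assumes "finite V" "\<And>x. x \<in> V \<Longrightarrow> c x < k"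
    and "\<And>i. i < k \<Longrightarrow> class_size V c i = q \<or> class_size V c i = Suc q"
  shows "2 * int (card (forward_pairs V c)) = turan_twice k q (card V)"
proof -
  have "(\<Sum>i<k. (int (class_size V c i) - int q) * (int (class_size V c i) - int q - 1)) = 0"
  proof (rule sum.neutral, intro ballI)
    fix i assume "i \<in> {..<k}"
    thus "(int (class_size V c i) - int q) * (int (class_size V c i) - int q - 1) = 0"
      using assms(3)[of i] by auto
  qed
  thus ?thesis using card_forward_pairs[OF assms(1,2), where q = q] by simp
qed

text \<open>Residues mod k supply a concrete balanced colouring, from which a Turan digraph is
  built.\<close>

lemma class_size_mod:
  assumes "r < k" "i < k"
  shows "class_size {..<q * k + r} (\<lambda>x. x mod k) i = q + of_bool (i < r)"
proof -
  have "{x \<in> {..<q * k + r}. x mod k = i} = (\<lambda>j. i + j * k) ` {..<q + of_bool (i < r)}"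
  proof (intro equalityI subsetI)
    fix x assume x: "x \<in> {x \<in> {..<q * k + r}. x mod k = i}"
    hence xe: "x = i + (x div k) * k" using mod_div_mult_eq[of x k] by simp
    have "x div k < q + of_bool (i < r)"
    proof (rule ccontr)
      assume "\<not> ?thesis"
      hence "(q + of_bool (i < r)) * k \<le> (x div k) * k" by (intro mult_le_mono1) simp
      hence "i + (q + of_bool (i < r)) * k \<le> x" using xe by linarith
      thus False using x assms by (cases "i < r") auto
    qed
    thus "x \<in> (\<lambda>j. i + j * k) ` {..<q + of_bool (i < r)}" using xe by blast
  next
    fix x assume "x \<in> (\<lambda>j. i + j * k) ` {..<q + of_bool (i < r)}"
    then obtain j where j: "x = i + j * k" "j < q + of_bool (i < r)" by blast
    have "x < q * k + r"
    proof (cases "j < q")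
      case True
      hence "Suc j * k \<le> q * k" by (intro mult_le_mono1) simp
      thus ?thesis using j assms by simp
    next
      case False
      hence "j = q" "i < r" using j(2) by (auto simp: of_bool_def split: if_splits)
      thus ?thesis using j(1) by simp
    qed
    thus "x \<in> {x \<in> {..<q * k + r}. x mod k = i}" using j(1) assms by simp
  qed
  moreover have "inj_on (\<lambda>j. i + j * k) {..<q + of_bool (i < r)}"
    using assms by (auto simp: inj_on_def)
  ultimately show ?thesis by (simp add: class_size_def card_image)
qed

text \<open>Colours increase strictly along a path, and only k of them are available.\<close>

lemma path_bounded_forward_pairs:
  assumes "\<And>x. x \<in> V \<Longrightarrow> c x < k"
  shows "path_bounded (forward_pairs V c) k V"
  unfolding path_bounded_def
proof (intro allI impI)
  fix p assume p: "dipath (forward_pairs V c) p" "set p \<subseteq> V"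
  have "successively (\<lambda>x y. c x < c y) p"
    using p(1) unfolding dipath_def by (auto simp: forward_pairs_def elim: successively_mono)
  hence "sorted_wrt (<) (map c p)"
    by (simp add: successively_map flip: successively_conv_sorted_wrt)
  hence "card (set (map c p)) = length p"
    using distinct_card[of "map c p"] strict_sorted_iff by auto
  moreover have "card (set (map c p)) \<le> card {..<k}"
    by (rule card_mono) (use p(2) assms in auto)
  ultimately show "length p \<le> k" by simp
qed

section \<open>Turan digraphs\<close>

text \<open>The only bridge between subdigraph isomorphism and paths as vertex lists; k bounds the
  number of vertices, so k+1 is the order of the forbidden path.\<close>

lemma H_free_dpath_iff:
  fixes D :: "'a pair_pre_digraph"
  assumes D: "pair_digraph D"
  shows "H_free (dpath (k + 1)) D \<longleftrightarrow> path_bounded (parcs D) k (pverts D)"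
proof -
  interpret pair_digraph D by fact
  let ?P = "with_proj (dpath (k + 1))"
  have wfP: "wf_digraph ?P"
    by unfold_locales (auto simp: dpath_def)
  have "\<exists>S. subgraph S (with_proj D) \<and> digraph_iso ?P S"
    if p: "dipath (parcs D) p" "set p \<subseteq> pverts D" "k < length p" for p
  proof -
    \<comment> \<open>Only the first k+1 entries are used, so p may be longer than the forbidden
      path.\<close>
    let ?S = "\<lparr>pverts = (!) p ` {..<k + 1}, parcs = (\<lambda>(i, j). (p ! i, p ! j)) ` parcs (dpath (k + 1))\<rparr>"
    let ?f = "\<lparr>iso_verts = (!) p, iso_arcs = (\<lambda>(i, j). (p ! i, p ! j)), iso_head = snd, iso_tail = fst\<rparr>"
    have dist: "distinct p" and succ: "\<And>i. Suc i < length p \<Longrightarrow> (p ! i, p ! Suc i) \<in> parcs D"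
      using p(1) unfolding dipath_def successively_conv_nth by blast+
    have "subgraph (with_proj ?S) (with_proj D)"
    proof (rule subgraphI)
      show "verts (with_proj ?S) \<subseteq> verts (with_proj D)" using p(2,3) nth_mem[of _ p] by force
      show "arcs (with_proj ?S) \<subseteq> arcs (with_proj D)"
        using succ p(3) by (auto simp: dpath_def)
      show "compatible (with_proj D) (with_proj ?S)" by rule
      show "wf_digraph (with_proj ?S)" by unfold_locales (auto simp: dpath_def)
      show "wf_digraph (with_proj D)" by unfold_locales
    qed
    moreover have "pre_digraph.digraph_isomorphism ?P ?f"
      unfolding pre_digraph.digraph_isomorphism_def
      using dist p(3) wfP by (auto simp: dpath_def inj_on_def nth_eq_iff_index_eq)
    moreover have "with_proj ?S = app_iso ?f ?P"
      by (simp add: app_iso_def with_proj_def dpath_def)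
    ultimately show ?thesis unfolding digraph_iso_def by blast
  qed
  moreover have "\<exists>p. dipath (parcs D) p \<and> set p \<subseteq> pverts D \<and> k < length p"
    if S: "subgraph S (with_proj D)" and iso: "digraph_iso ?P S" for S
  proof -
    obtain f where f: "pre_digraph.digraph_isomorphism ?P f" "S = app_iso f ?P"
      using iso by (auto simp: digraph_iso_def)
    \<comment> \<open>An isomorphism may install arbitrary tail and head maps; being a subgraph of D
      forces them to be the pair projections, so that mapped arcs are genuine arcs of D.\<close>
    have compat: "iso_tail f = fst" "iso_head f = snd"
      using S f(2) by (auto simp: subgraph_def compatible_def)
    let ?p = "map (iso_verts f) [0..<k + 1]"
    have inj: "inj_on (iso_verts f) {..<k + 1}"
      using f(1) by (simp add: pre_digraph.digraph_isomorphism_def dpath_def)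
    have arc: "(iso_verts f i, iso_verts f (Suc i)) \<in> parcs D" if i: "Suc i < k + 1" for i
    proof -
      let ?a = "(i, Suc i)"
      have a: "?a \<in> arcs ?P" using i by (auto simp: dpath_def)
      hence "iso_verts f i = fst (iso_arcs f ?a)" "iso_verts f (Suc i) = snd (iso_arcs f ?a)"
        using f(1) compat by (auto simp: pre_digraph.digraph_isomorphism_def)
      moreover have "iso_arcs f ?a \<in> parcs D" using S f(2) a by (auto simp: subgraph_def)
      ultimately show ?thesis by simp
    qed
    have "distinct ?p" using inj by (simp add: distinct_map atLeast0LessThan del: upt_Suc)
    moreover have "successively (\<lambda>x y. (x, y) \<in> parcs D) ?p"
      using arc by (simp add: successively_conv_nth del: upt_Suc)
    moreover have "set ?p \<subseteq> pverts D"
      using S f(2) by (auto simp: subgraph_def dpath_def)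
    ultimately show ?thesis by (intro exI[of _ ?p]) (simp add: dipath_def del: upt_Suc)
  qed
  ultimately show ?thesis unfolding H_free_def path_bounded_def by (meson not_le)
qed

text \<open>Parts numbered 1, ..., k become colours 0, ..., k-1. Parts of a partition are nonempty,
  so q >= 1 is what turns a balanced colouring into a partition with k parts.\<close>

lemma turan_digraphs_iff:
  assumes k: "k \<ge> 1" and n: "n = q * k + r" "r < k" "q \<ge> 1"
  shows "D \<in> turan_digraphs n k \<longleftrightarrow> pair_digraph D \<and> card (pverts D) = n \<and>
    (\<exists>c. (\<forall>x\<in>pverts D. c x < k) \<and> parcs D = forward_pairs (pverts D) c \<and>
      (\<forall>i<k. class_size (pverts D) c i = q \<or> class_size (pverts D) c i = Suc q))"
    (is "_ \<longleftrightarrow> _ \<and> _ \<and> ?R")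
proof (intro iffI conjI)
  assume T: "D \<in> turan_digraphs n k"
  thus D: "pair_digraph D" and cD: "card (pverts D) = n" by (simp_all add: turan_digraphs_def)
  interpret pair_digraph D by fact
  obtain V where part: "partition_on (pverts D) (V ` {1..k})" and inj: "inj_on V {1..k}"
    and bal: "\<forall>i\<in>{1..k}. \<forall>j\<in>{1..k}. card (V i) \<le> card (V j) + 1"
    and ind: "\<forall>i\<in>{1..k}. \<forall>u\<in>V i. \<forall>v\<in>V i. (u, v) \<notin> parcs D"
    and fwd: "\<forall>i\<in>{1..k}. \<forall>j\<in>{1..k}. i < j \<longrightarrow> mapsto D (V i) (V j)"
    using T unfolding turan_digraphs_def by blast
  have un: "pverts D = (\<Union>i\<in>{1..k}. V i)" using part by (auto simp: partition_on_def)
  have disj: "i = j" if "i \<in> {1..k}" "j \<in> {1..k}" "x \<in> V i" "x \<in> V j" for i j x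
  proof (rule ccontr)
    assume "i \<noteq> j"
    hence "V i \<noteq> V j" using inj that by (auto dest: inj_onD)
    hence "V i \<inter> V j = {}" using part that by (auto simp: partition_on_def disjoint_def)
    thus False using that by blast
  qed
  have "\<forall>x\<in>pverts D. \<exists>i. i \<in> {1..k} \<and> x \<in> V i" using un by blast
  then obtain d where "\<forall>x\<in>pverts D. d x \<in> {1..k} \<and> x \<in> V (d x)" unfolding bchoice_iff ..
  hence d: "d x \<in> {1..k} \<and> x \<in> V (d x)" if "x \<in> pverts D" for x using that by blast
  define c where "c x = d x - 1" for x
  have dc: "d x = Suc (c x)" if "x \<in> pverts D" for x using d[OF that] by (simp add: c_def)
  have c: "c x < k" if "x \<in> pverts D" for x using d[OF that] dc[OF that] by simp
  have cls: "{x \<in> pverts D. c x = i} = V (Suc i)" if "i < k" for i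
  proof (intro equalityI subsetI)
    fix x assume "x \<in> {x \<in> pverts D. c x = i}"
    thus "x \<in> V (Suc i)" using d[of x] dc[of x] by auto
  next
    fix x assume x: "x \<in> V (Suc i)"
    hence xD: "x \<in> pverts D" using un that by auto
    hence "d x = Suc i" using disj[of "d x" "Suc i" x] d[OF xD] x that by simp
    thus "x \<in> {x \<in> pverts D. c x = i}" using xD by (simp add: c_def)
  qed
  have arc_iff: "(x, y) \<in> parcs D \<longleftrightarrow> c x < c y" if x: "x \<in> pverts D" and y: "y \<in> pverts D" for x y
  proof -
    consider "d x < d y" | "d x = d y" | "d y < d x" by linarith
    thus ?thesis
    proof cases
      case 1
      hence "(x, y) \<in> parcs D" using fwd d[OF x] d[OF y] unfolding mapsto_def by blast
      thus ?thesis using 1 dc x y by simp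
    next
      case 2
      hence "y \<in> V (d x)" using d[OF y] by simp
      hence "(x, y) \<notin> parcs D" using ind d[OF x] by blast
      thus ?thesis using 2 dc x y by simp
    next
      case 3
      hence "(x, y) \<notin> parcs D" using fwd d[OF x] d[OF y] unfolding mapsto_def by blast
      thus ?thesis using 3 dc x y by simp
    qed
  qed
  have "(x, y) \<in> parcs D \<longleftrightarrow> (x, y) \<in> forward_pairs (pverts D) c" for x y
    unfolding forward_pairs_def using arc_iff[of x y] in_arcsD1[of x y] in_arcsD2[of x y] by blast
  hence E: "parcs D = forward_pairs (pverts D) c" by (intro set_eqI) (metis surj_pair)
  have "class_size (pverts D) c i = q \<or> class_size (pverts D) c i = Suc q" if "i < k" for i
  proof (rule balanced_sizes[OF _ n(2) _ that])
    show "(\<Sum>i<k. class_size (pverts D) c i) = q * k + r"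
      using sum_class_size[of "pverts D" c k] c cD n(1) pair_finite_verts by simp
    show "class_size (pverts D) c i \<le> class_size (pverts D) c j + 1" if "i < k" "j < k" for i j
      unfolding class_size_def cls[OF that(1)] cls[OF that(2)] using bal that by simp
  qed
  with E c show ?R by (intro exI[of _ c]) simp
next
  assume A: "pair_digraph D \<and> card (pverts D) = n \<and> ?R"
  interpret pair_digraph D using A by blast
  obtain c where c: "\<forall>x\<in>pverts D. c x < k" and E: "parcs D = forward_pairs (pverts D) c"
    and bal: "\<forall>i<k. class_size (pverts D) c i = q \<or> class_size (pverts D) c i = Suc q"
    using A by blast
  define V where "V i = {x \<in> pverts D. c x = i - 1}" for i
  have cV: "card (V i) = q \<or> card (V i) = Suc q" if "i \<in> {1..k}" for i
  proof -
    have "i - 1 < k" using that by auto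
    thus ?thesis using bal by (auto simp: V_def class_size_def)
  qed
  have ne: "V i \<noteq> {}" if "i \<in> {1..k}" for i
    using cV[OF that] n(3) by auto
  have disj: "i = j" if "i \<in> {1..k}" "j \<in> {1..k}" "x \<in> V i" "x \<in> V j" for i j x
    using that by (auto simp: V_def)
  have "pverts D \<subseteq> (\<Union>i\<in>{1..k}. V i)"
  proof
    fix x assume x: "x \<in> pverts D"
    hence "x \<in> V (Suc (c x))" "Suc (c x) \<in> {1..k}" using c x by (auto simp: V_def)
    thus "x \<in> (\<Union>i\<in>{1..k}. V i)" by blast
  qed
  moreover have "(\<Union>i\<in>{1..k}. V i) \<subseteq> pverts D" by (auto simp: V_def)
  moreover have "disjoint (V ` {1..k})"
  proof (rule disjointI)
    fix A B assume "A \<in> V ` {1..k}" "B \<in> V ` {1..k}" "A \<noteq> B"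
    then obtain i j where ij: "i \<in> {1..k}" "j \<in> {1..k}" "A = V i" "B = V j" by blast
    thus "A \<inter> B = {}" using disj[OF ij(1,2)] \<open>A \<noteq> B\<close> by blast
  qed
  moreover have "{} \<notin> V ` {1..k}" using ne by (metis imageE)
  ultimately have "partition_on (pverts D) (V ` {1..k})"
    unfolding partition_on_def by (intro conjI equalityI) simp_all
  moreover have "inj_on V {1..k}"
  proof (rule inj_onI)
    fix i j assume ij: "i \<in> {1..k}" "j \<in> {1..k}" "V i = V j"
    then obtain x where "x \<in> V i" using ne by blast
    thus "i = j" using disj[OF ij(1,2)] ij(3) by simp
  qed
  moreover have "\<forall>i\<in>{1..k}. \<forall>j\<in>{1..k}. card (V i) \<le> card (V j) + 1"
  proof (intro ballI)
    fix i j assume "i \<in> {1..k}" "j \<in> {1..k}"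
    thus "card (V i) \<le> card (V j) + 1" using cV[of i] cV[of j] by auto
  qed
  moreover have "\<forall>i\<in>{1..k}. \<forall>u\<in>V i. \<forall>v\<in>V i. (u, v) \<notin> parcs D"
    unfolding E by (auto simp: forward_pairs_def V_def)
  moreover have "\<forall>i\<in>{1..k}. \<forall>j\<in>{1..k}. i < j \<longrightarrow> mapsto D (V i) (V j)"
    unfolding E mapsto_def by (auto simp: forward_pairs_def V_def)
  ultimately show "D \<in> turan_digraphs n k"
    using A unfolding turan_digraphs_def by (intro CollectI conjI exI[of _ V]) simp_all
qed

lemma turan_digraph_free:
  assumes k: "k \<ge> 1" and n: "n = q * k + r" "r < k" "q \<ge> 1" and T: "D \<in> turan_digraphs n k"
  shows "D \<in> free_digraphs n (dpath (k + 1))" "2 * int (num_arcs D) = turan_twice k q n"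
proof -
  have D: "pair_digraph D" "card (pverts D) = n"
    using T by (simp_all add: turan_digraphs_def)
  interpret pair_digraph D by fact
  obtain c where c: "\<And>x. x \<in> pverts D \<Longrightarrow> c x < k" and E: "parcs D = forward_pairs (pverts D) c"
    and bal: "\<And>i. i < k \<Longrightarrow> class_size (pverts D) c i = q \<or> class_size (pverts D) c i = Suc q"
    using T unfolding turan_digraphs_iff[OF k n] by blast
  have "path_bounded (parcs D) k (pverts D)"
    unfolding E using c by (rule path_bounded_forward_pairs)
  thus "D \<in> free_digraphs n (dpath (k + 1))"
    using D H_free_dpath_iff[OF D(1)] by (simp add: free_digraphs_def)
  show "2 * int (num_arcs D) = turan_twice k q n"
    unfolding num_arcs_def E D(2)[symmetric]
    by (rule card_forward_pairs_balanced[OF pair_finite_verts c bal])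
qed

lemma turan_digraph_exists:
  assumes k: "k \<ge> 1" and n: "n = q * k + r" "r < k" "q \<ge> 1"
  shows "turan_digraphs n k \<noteq> {}"
proof -
  let ?D = "\<lparr>pverts = {..<n}, parcs = forward_pairs {..<n} (\<lambda>x. x mod k)\<rparr>"
  have "pair_digraph ?D"
    by unfold_locales (simp_all add: finite_forward_pairs, auto simp: forward_pairs_def)
  moreover have "\<forall>i<k. class_size {..<n} (\<lambda>x. x mod k) i = q \<or> class_size {..<n} (\<lambda>x. x mod k) i = Suc q"
    unfolding n(1) using class_size_mod[OF n(2)] by auto
  ultimately have "?D \<in> turan_digraphs n k"
    unfolding turan_digraphs_iff[OF k n] using k by (intro conjI exI[of _ "\<lambda>x. x mod k"]) auto
  thus ?thesis by blast
qed

section \<open>The extremal number and the extremal family\<close>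

lemma free_digraph_bound:
  assumes k: "k \<ge> 1" and n: "n = q * k + r" "r < k" "q \<ge> 1" and N: "threshold k \<le> n"
    and D: "D \<in> free_digraphs n (dpath (k + 1))" and e: "turan_twice k q n \<le> 2 * int (num_arcs D)"
  shows "2 * int (num_arcs D) = turan_twice k q n" "D \<in> turan_digraphs n k"
proof -
  have D': "pair_digraph D" "card (pverts D) = n" "path_bounded (parcs D) k (pverts D)"
    using D H_free_dpath_iff by (auto simp: free_digraphs_def)
  interpret pair_digraph D by fact
  have E: "parcs D \<subseteq> pverts D \<times> pverts D" "irrefl (parcs D)"
    using in_arcsD1 in_arcsD2 pair_no_loops by (auto simp: irrefl_def) fastforce
  note ex = extremal_structure[OF k pair_finite_verts E D'(3), unfolded D'(2), OF N n(1,2) e[unfolded num_arcs_def]]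
  show "2 * int (num_arcs D) = turan_twice k q n" unfolding num_arcs_def by (rule ex(1))
  show "D \<in> turan_digraphs n k"
    unfolding turan_digraphs_iff[OF k n] using D'(1,2) ex(2) by blast
qed

theorem theorem1p6:
  fixes k :: nat
  assumes "k \<ge> 1"
  shows "\<exists>n0::nat. \<forall>n\<ge>n0. \<forall>q r :: nat. n = q * k + r \<and> r < k \<longrightarrow>
    (\<forall>T \<in> turan_digraphs n k. ex_num n (dpath (k + 1)) = num_arcs T) \<and>
    real (ex_num n (dpath (k + 1))) =
      (real k - 1) / (2 * real k) * (real n)\<^sup>2 - real r * (real k - real r) / (2 * real k) \<and>
    EX_fam n (dpath (k + 1)) = turan_digraphs n k"
proof (intro exI[of _ "max (threshold k) k"] allI impI)
  fix n q r :: nat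
  assume N: "max (threshold k) k \<le> n" and "n = q * k + r \<and> r < k"
  hence n: "n = q * k + r" "r < k" by auto
  \<comment> \<open>The bound n >= k enters the threshold to guarantee k nonempty parts.\<close>
  have q: "q \<ge> 1"
  proof (rule ccontr)
    assume "\<not> q \<ge> 1"
    hence "q = 0" by simp
    thus False using N n by simp
  qed
  have th: "threshold k \<le> n" using N by simp
  let ?F = "free_digraphs n (dpath (k + 1))" and ?t = "turan_twice k q n"
  note free = turan_digraph_free[OF assms n q] and bound = free_digraph_bound[OF assms n q th]
  obtain T where T: "T \<in> turan_digraphs n k" using turan_digraph_exists[OF assms n q] by blast
  \<comment> \<open>A digraph exceeding the bound would in particular attain it, and
    \<open>bound(1)\<close> would then give equality.\<close>
  have le: "2 * int (num_arcs D) \<le> ?t" if "D \<in> ?F" for D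
    using bound(1)[OF that] by linarith
  have "num_arcs D \<le> num_arcs T" if "D \<in> ?F" for D
    using le[OF that] free(2)[OF T] by linarith
  hence "ex_num n (dpath (k + 1)) = num_arcs T"
    unfolding ex_num_def using free(1)[OF T]
    by (intro Max_eqI) (auto intro: finite_subset[of _ "{..num_arcs T}"])
  hence ex: "2 * int (ex_num n (dpath (k + 1))) = ?t" using free(2)[OF T] by simp
  have "ex_num n (dpath (k + 1)) = num_arcs T'" if "T' \<in> turan_digraphs n k" for T'
    using free(2)[OF that] ex by linarith
  moreover have "real (ex_num n (dpath (k + 1))) =
      (real k - 1) / (2 * real k) * (real n)\<^sup>2 - real r * (real k - real r) / (2 * real k)"
    using turan_twice_real[OF assms n(1)] unfolding ex[symmetric] by simp
  moreover have "EX_fam n (dpath (k + 1)) = turan_digraphs n k"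
  proof (intro equalityI subsetI)
    fix D assume "D \<in> EX_fam n (dpath (k + 1))"
    hence "D \<in> ?F" "?t \<le> 2 * int (num_arcs D)" using ex by (auto simp: EX_fam_def)
    thus "D \<in> turan_digraphs n k" by (rule bound(2))
  next
    fix D assume D: "D \<in> turan_digraphs n k"
    show "D \<in> EX_fam n (dpath (k + 1))"
      using free(1)[OF D] calculation(1)[OF D] by (simp add: EX_fam_def)
  qed
  ultimately show "(\<forall>T \<in> turan_digraphs n k. ex_num n (dpath (k + 1)) = num_arcs T) \<and>
    real (ex_num n (dpath (k + 1))) =
      (real k - 1) / (2 * real k) * (real n)\<^sup>2 - real r * (real k - real r) / (2 * real k) \<and>
    EX_fam n (dpath (k + 1)) = turan_digraphs n k" by blast
qed

end
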